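(* Let $w$ be a variance profile, and let $f:\mathbb{C}\to\mathbb{C}$ be analytic on $\mathbb{D}_{\rho+\tau}$ for some $\tau>0$ and bounded elsewhere, where $\rho\ge1$ is the norm constant of the random band matrices described in the context. For $\nu\in(0,1]$ let $$\sigma_f^2(\nu)=-\frac{\nu}{4\pi^2}\sum_{k\in\mathbb{Z}}\oint_{\partial\mathbb{D}_{1}}\oint_{\partial\mathbb{D}_{1}}\frac{f(z)\overline{f(\eta)}\,\hat w_\nu(k)}{(z\bar\eta-\hat w_\nu(k))^2}\,dz\,d\bar\eta,$$ the limiting variance of $\sqrt{c_n/n}\,\mathcal{L}_f^{\Delta}(M)$ when $M$ is the periodic band matrix with $c_n/n\to\nu$, and let $$\sigma_f^2(0)=-\frac{1}{4\pi^2}\int_{\mathbb{R}}\oint_{\partial\mathbb{D}_{1}}\oint_{\partial\mathbb{D}_{1}}\frac{f(z)\overline{f(\eta)}\,\hat w_0(t)}{(z\bar\eta-\hat w_0(t))^2}\,dz\,d\bar\eta\,dt,$$ the corresponding limiting variance when $c_n/n\to0$. Then $\sigma_f^2(\nu)\to\sigma_f^2(0)$ as $\nu\downarrow0$.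
   Context: Notation. $\mathbb{D}_r=\{z\in\mathbb{C}:|z|\le r\}$, $\partial\mathbb{D}_r=\{z\in\mathbb{C}:|z|=r\}$; $\|\cdot\|$ is the operator norm. For an $n\times n$ matrix $A$ with eigenvalues $\lambda_1(A),\dots,\lambda_n(A)$, $\mathcal{L}_f^{\Delta}(A)=\sum_{i=1}^n f(\lambda_i(A))-nf(0)$. Variance profile. $w:\mathbb{R}\to[0,\infty)$ is piecewise continuous, supported on $[-1/2,1/2]$, continuous at $0$, with $\int_{-1/2}^{1/2}w(x)\,dx=1$. For $\nu\in(0,1]$, $w_\nu$ is the $1/\nu$-periodic function with $w_\nu=w$ on $[-\frac1{2\nu},\frac1{2\nu}]$; and $w_0=w$ on $\mathbb{R}$. Set $\omega=\sup_x w(x)$, $\hat w_\nu(k)=\int_{-1/2}^{1/2}w(x)e^{2\pi ikx\nu}\,dx$ for $k\in\mathbb{Z}$, and $\hat w_0(t)=\int_{-1/2}^{1/2}w(x)e^{2\pi itx}\,dx$ for $t\in\mathbb{R}$. Band matrices. For each $n$ let $\{x_{ij}:1\le i,j\le n\}$ be i.i.d. complex random variables; the bandwidth is $b_n=(c_n-1)/2$. If $\lim_n c_n/n=\nu\in(0,1]$, the periodic band matrix $M$ has entries $m_{ij}=\frac1{\sqrt{c_n}}x_{ij}\sqrt{w_\nu(\frac{i-j}{c_n})}$. If $c_n=o(n)$, $M$ is either the non-periodic band matrix with entries $m_{ij}=\frac1{\sqrt{c_n}}x_{ij}\sqrt{w_0(\frac{i-j}{c_n})}$ or the periodic one with entries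 $m_{ij}=\frac{1}{\sqrt{c_n}}x_{ij}\Bigl[\sqrt{w_0(\tfrac{i-j}{c_n})}+\sqrt{w_0(\tfrac{i-j+n}{c_n})}+\sqrt{w_0(\tfrac{i-j-n}{c_n})}\Bigr]$. Assumptions on the entries. (i) $\mathbb{E}[x_{ij}]=0$, $\mathbb{E}[|x_{ij}|^2]=1$. (ii) The $x_{ij}$ are continuous random variables with bounded density and satisfy the Poincaré inequality with some universal constant $\alpha\in(0,\infty)$: $\mathrm{Var}(h(x_{ij}))\le\frac1\alpha\mathbb{E}[|h'(x_{ij})|^2]$ for every differentiable $h:\mathbb{C}\to\mathbb{C}$, with $\mathbb{C}$ identified with $\mathbb{R}^2$. (iii) Either $n\ge c_n\ge\log^3 n$ and $\mathbb{E}[x_{ij}^p]=0$ for all $p\in\mathbb{N}$; or $\lim_n c_n/n=\nu\in(0,1]$ and $\mathbb{E}[x_{ij}^2]=0$. Norm constant. $\rho\ge1$ is a fixed constant such that, for a universal constant $K>0$, $\mathbb{P}(\|M\|>\rho/4+t)\le K\exp\bigl(-\sqrt{\alpha c_n/(2\omega)}\;t\bigr)$ for all $t>0$; in particular, almost surely $\|M\|\le\rho$ for all large $n$. *)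

theory Defs
  imports "HOL-Probability.Probability" "HOL-Complex_Analysis.Complex_Analysis"
begin

definition piecewise_continuous :: "(real \<Rightarrow> real) \<Rightarrow> bool" where
  "piecewise_continuous w \<longleftrightarrow> finite {x. \<not> isCont w x} \<and>
     (\<forall>x. (\<exists>l. (w \<longlongrightarrow> l) (at_left x)) \<and> (\<exists>l. (w \<longlongrightarrow> l) (at_right x)))"

definition variance_profile :: "(real \<Rightarrow> real) \<Rightarrow> bool" where
  "variance_profile w \<longleftrightarrow>
     (\<forall>x. 0 \<le> w x) \<and> piecewise_continuous w \<and> (\<forall>x. x \<notin> {-1/2..1/2} \<longrightarrow> w x = 0) \<and>
     isCont w 0 \<and> (w has_integral 1) {-1/2..1/2}"

text \<open>The \<open>1/\<nu>\<close>-periodic extension. The closed period in the usual definition is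
  ambiguous only at its two endpoints, and only for \<open>\<nu> = 1\<close>; here it is
  \<open>[-1/(2\<nu>), 1/(2\<nu>))\<close>.\<close>

definition profile_per :: "(real \<Rightarrow> real) \<Rightarrow> real \<Rightarrow> real \<Rightarrow> real" where
  "profile_per w \<nu> x = (if \<nu> = 0 then w x else w (x - of_int (round (\<nu> * x)) / \<nu>))"

definition w_hat :: "(real \<Rightarrow> real) \<Rightarrow> real \<Rightarrow> int \<Rightarrow> complex" where
  "w_hat w \<nu> k = integral {-1/2..1/2} (\<lambda>x. of_real (w x) * cis (2 * pi * of_int k * x * \<nu>))"

definition w_hat0 :: "(real \<Rightarrow> real) \<Rightarrow> real \<Rightarrow> complex" where
  "w_hat0 w t = integral {-1/2..1/2} (\<lambda>x. of_real (w x) * cis (2 * pi * t * x))"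

datatype band_type = Proportional real | Sublinear | Sublinear_Periodic

fun band_regime :: "band_type \<Rightarrow> (nat \<Rightarrow> real) \<Rightarrow> bool" where
  "band_regime (Proportional \<nu>) c \<longleftrightarrow> 0 < \<nu> \<and> \<nu> \<le> 1 \<and> (\<lambda>n. c n / real n) \<longlonglongrightarrow> \<nu>"
| "band_regime Sublinear c \<longleftrightarrow> (\<lambda>n. c n / real n) \<longlonglongrightarrow> 0"
| "band_regime Sublinear_Periodic c \<longleftrightarrow> (\<lambda>n. c n / real n) \<longlonglongrightarrow> 0"

fun band_weight :: "(real \<Rightarrow> real) \<Rightarrow> band_type \<Rightarrow> real \<Rightarrow> nat \<Rightarrow> real \<Rightarrow> real" where
  "band_weight w (Proportional \<nu>) c n d = sqrt (profile_per w \<nu> (d / c))"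
| "band_weight w Sublinear c n d = sqrt (profile_per w 0 (d / c))"
| "band_weight w Sublinear_Periodic c n d =
     sqrt (profile_per w 0 (d / c)) + sqrt (profile_per w 0 ((d + real n) / c))
       + sqrt (profile_per w 0 ((d - real n) / c))"

definition band_matrix ::
  "(real \<Rightarrow> real) \<Rightarrow> band_type \<Rightarrow> (nat \<Rightarrow> real) \<Rightarrow> (nat \<Rightarrow> nat \<Rightarrow> nat \<Rightarrow> 'a \<Rightarrow> complex)
     \<Rightarrow> nat \<Rightarrow> 'a \<Rightarrow> nat \<Rightarrow> nat \<Rightarrow> complex" where
  "band_matrix w B c x n s i j =
     of_real (1 / sqrt (c n)) * x n i j s * of_real (band_weight w B (c n) n (real i - real j))"

definition op_norm :: "nat \<Rightarrow> (nat \<Rightarrow> nat \<Rightarrow> complex) \<Rightarrow> real" where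
  "op_norm n A = (SUP v \<in> {v :: nat \<Rightarrow> complex. L2_set (\<lambda>j. cmod (v j)) {1..n} \<le> 1}.
     L2_set (\<lambda>i. cmod (\<Sum>j\<in>{1..n}. A i j * v j)) {1..n})"

text \<open>Test functions are differentiable in the real sense, and \<open>|h'|\<^sup>2\<close> is the sum of the
  squared moduli of the two real partial derivatives.\<close>

definition poincare_ineq :: "'a measure \<Rightarrow> real \<Rightarrow> ('a \<Rightarrow> complex) \<Rightarrow> bool" where
  "poincare_ineq P \<alpha> X \<longleftrightarrow>
     (\<forall>(h :: complex \<Rightarrow> complex) h'. (\<forall>z. (h has_derivative h' z) (at z)) \<longrightarrow>
        (\<integral>\<^sup>+s. ennreal ((cmod (h (X s) - (\<integral>s'. h (X s') \<partial>P)))\<^sup>2) \<partial>P)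
          \<le> ennreal (1 / \<alpha>) *
             (\<integral>\<^sup>+s. ennreal ((cmod (h' (X s) 1))\<^sup>2 + (cmod (h' (X s) \<i>))\<^sup>2) \<partial>P))"

definition band_ensemble ::
  "'a measure \<Rightarrow> band_type \<Rightarrow> (nat \<Rightarrow> real) \<Rightarrow> real
     \<Rightarrow> (nat \<Rightarrow> nat \<Rightarrow> nat \<Rightarrow> 'a \<Rightarrow> complex) \<Rightarrow> bool" where
  "band_ensemble P B c \<alpha> x \<longleftrightarrow>
     prob_space P \<and> band_regime B c \<and> 0 < \<alpha> \<and>
     (\<forall>n. prob_space.indep_vars P (\<lambda>_. borel) (\<lambda>(i, j). x n i j) ({1..n} \<times> {1..n})) \<and>
     (\<forall>n. \<forall>i\<in>{1..n}. \<forall>j\<in>{1..n}. \<forall>k\<in>{1..n}. \<forall>l\<in>{1..n}.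
        distr P borel (x n i j) = distr P borel (x n k l)) \<and>
     (\<forall>n. \<forall>i\<in>{1..n}. \<forall>j\<in>{1..n}.
        has_bochner_integral P (x n i j) 0 \<and>
        has_bochner_integral P (\<lambda>s. (cmod (x n i j s))\<^sup>2) 1 \<and>
        (\<exists>g D. distributed P lborel (x n i j) (\<lambda>z. ennreal (g z)) \<and> (\<forall>z. 0 \<le> g z \<and> g z \<le> D)) \<and>
        poincare_ineq P \<alpha> (x n i j)) \<and>
     ((\<forall>\<^sub>F n in sequentially. ln (real n) ^ 3 \<le> c n \<and> c n \<le> real n) \<and>
        (\<forall>n. \<forall>i\<in>{1..n}. \<forall>j\<in>{1..n}. \<forall>p\<ge>1. has_bochner_integral P (\<lambda>s. x n i j s ^ p) 0)
      \<or> (\<exists>\<nu>. 0 < \<nu> \<and> \<nu> \<le> 1 \<and> (\<lambda>n. c n / real n) \<longlonglongrightarrow> \<nu>) \<and>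
        (\<forall>n. \<forall>i\<in>{1..n}. \<forall>j\<in>{1..n}. has_bochner_integral P (\<lambda>s. (x n i j s)\<^sup>2) 0))"

definition norm_constant ::
  "'a measure \<Rightarrow> (real \<Rightarrow> real) \<Rightarrow> band_type \<Rightarrow> (nat \<Rightarrow> real) \<Rightarrow> real
     \<Rightarrow> (nat \<Rightarrow> nat \<Rightarrow> nat \<Rightarrow> 'a \<Rightarrow> complex) \<Rightarrow> real \<Rightarrow> bool" where
  "norm_constant P w B c \<alpha> x \<rho> \<longleftrightarrow> 1 \<le> \<rho> \<and>
     (\<exists>K>0. \<forall>\<^sub>F n in sequentially. \<forall>t>0.
        measure P {s \<in> space P. op_norm n (band_matrix w B c x n s) > \<rho> / 4 + t}
          \<le> K * exp (- sqrt (\<alpha> * c n / (2 * (SUP y. w y))) * t))"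

text \<open>The variable \<open>u\<close> is \<open>\<eta>\<close> conjugated, and its circle is positively oriented. With this
  orientation the prefactor \<open>-1/(4\<pi>\<^sup>2) = (1/(2\<pi>i))\<^sup>2\<close> makes the variance nonnegative;
  parametrising \<open>\<eta>\<close> itself counterclockwise would flip the sign of both variances.\<close>

definition circle_integral :: "(complex \<Rightarrow> complex) \<Rightarrow> real \<Rightarrow> complex \<Rightarrow> complex" where
  "circle_integral f r a =
     contour_integral (circlepath 0 r) (\<lambda>z. contour_integral (circlepath 0 r)
       (\<lambda>u. f z * cnj (f (cnj u)) * a / (z * u - a)\<^sup>2))"

text \<open>On unit circles the integrand is singular when \<open>|a| = 1\<close>. This occurs at frequency 0,
  where the transform of \<open>w\<close> is 1. That integral is read as the limit over circles
  shrinking to the unit circle from outside, where \<open>f\<close> is still analytic.\<close>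

definition unit_circle_integral :: "(complex \<Rightarrow> complex) \<Rightarrow> complex \<Rightarrow> complex" where
  "unit_circle_integral f a =
     (if cmod a < 1 then circle_integral f 1 a
      else Lim (at_right 1) (\<lambda>r. circle_integral f r a))"

text \<open>The sum and the integral over frequencies are symmetric limits: already for the
  indicator of \<open>[-1/2, 1/2]\<close> the transform is a sinc, and neither converges absolutely.\<close>

definition variance_pos :: "(real \<Rightarrow> real) \<Rightarrow> (complex \<Rightarrow> complex) \<Rightarrow> real \<Rightarrow> complex" where
  "variance_pos w f \<nu> = Lim sequentially (\<lambda>N.
     - of_real (\<nu> / (4 * pi\<^sup>2)) * (\<Sum>k\<in>{- int N..int N}. unit_circle_integral f (w_hat w \<nu> k)))"

definition variance_zero :: "(real \<Rightarrow> real) \<Rightarrow> (complex \<Rightarrow> complex) \<Rightarrow> complex" where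
  "variance_zero w f = Lim at_top (\<lambda>T::real.
     - of_real (1 / (4 * pi\<^sup>2)) * integral {-T..T} (\<lambda>t. unit_circle_integral f (w_hat0 w t)))"

definition limit_variance :: "(real \<Rightarrow> real) \<Rightarrow> (complex \<Rightarrow> complex) \<Rightarrow> real \<Rightarrow> complex" where
  "limit_variance w f \<nu> = (if \<nu> = 0 then variance_zero w f else variance_pos w f \<nu>)"

end

theory Submission
  imports Defs "HOL-Real_Asymp.Real_Asymp"
begin

text \<open>Expanding the geometric series under the contour integrals turns the double integral into
  \<open>-4\<pi>\<^sup>2 (\<gamma> a + a\<^sup>2 K a)\<close> with \<open>K\<close> holomorphic on a disc of radius greater than 1; this also settles
  the singular case \<open>cmod a = 1\<close>. With \<open>\<phi> = w_hat0 w\<close> the variances become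
  \<open>\<nu> \<Sum>\<^sub>k (\<gamma> \<phi> + \<phi>\<^sup>2 K(\<phi>)) (k \<nu>)\<close> and \<open>\<integral> \<gamma> \<phi> + \<phi>\<^sup>2 K(\<phi>)\<close>.

  Bessel's inequality shows that \<open>\<phi>\<close> and \<open>\<phi>'\<close> are square integrable, so \<open>\<phi>\<^sup>2 K(\<phi>)\<close> and its derivative
  are integrable, and the Riemann sums of this part are within \<open>O(\<nu>)\<close> of the integral.

  For the linear part, comparing Dirichlet kernels shows that the symmetric partial sums at mesh \<open>\<nu>\<close> and
  the symmetric partial integrals differ by a term that vanishes by the Riemann-Lebesgue lemma. As \<open>w\<close>
  need not have bounded variation, these may fail to converge; but they converge or diverge together,
  for every \<open>\<nu>\<close>, and to the same limit.\<close>

section \<open>Bessel's inequality for compactly supported functions\<close>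

text \<open>The class is closed under multiplication by measurable functions bounded on
  \<open>[-1/2, 1/2]\<close>. Modulations, the moment that differentiates the transform, and the
  cosecant factor used later all stay inside it.\<close>

definition bounded_supported :: "(real \<Rightarrow> complex) \<Rightarrow> bool" where
  "bounded_supported v \<longleftrightarrow> v \<in> borel_measurable borel \<and> (\<exists>C. \<forall>x. norm (v x) \<le> C) \<and>
     (\<forall>x. x \<notin> {-1/2..1/2} \<longrightarrow> v x = 0)"

text \<open>The positive sign in the exponent follows \<open>w_hat0\<close>; the Lebesgue integral
  gives direct access to Fubini's theorem.\<close>

definition fourier :: "(real \<Rightarrow> complex) \<Rightarrow> real \<Rightarrow> complex" where
  "fourier v t = (LINT x|lborel. v x * cis (2 * pi * t * x))"

lemma measurable_cis [measurable]: "cis \<in> borel_measurable borel"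
  by (intro borel_measurable_continuous_onI continuous_intros)

lemma measurable_cnj [measurable]: "cnj \<in> borel_measurable borel"
  by (intro borel_measurable_continuous_onI continuous_intros)

lemma bounded_supported_measurable [measurable_dest]:
  "bounded_supported v \<Longrightarrow> v \<in> borel_measurable borel"
  by (simp add: bounded_supported_def)

lemma bounded_supported_integrable:
  assumes "bounded_supported v"
  shows "integrable lborel v"
proof -
  obtain C where C: "\<And>x. norm (v x) \<le> C"
    using assms by (auto simp: bounded_supported_def)
  have [measurable]: "v \<in> borel_measurable borel"
    using assms by (simp add: bounded_supported_def)
  show ?thesis
    by (rule integrableI_bounded_set[where A = "{-1/2..1/2}" and B = C])
       (use assms C in \<open>auto simp: bounded_supported_def\<close>)
qed

lemma bounded_supported_mult:
  assumes v: "bounded_supported v" and h: "h \<in> borel_measurable borel"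
    and b: "\<And>x. x \<in> {-1/2..1/2} \<Longrightarrow> norm (h x) \<le> C"
  shows "bounded_supported (\<lambda>x. v x * h x)"
proof -
  obtain D where D: "\<And>x. norm (v x) \<le> D"
    using v by (auto simp: bounded_supported_def)
  have "norm (v x * h x) \<le> max 0 D * max 0 C" for x
  proof (cases "x \<in> {-1/2..1/2}")
    case True
    have "norm (v x) * norm (h x) \<le> max 0 D * max 0 C"
      using D[of x] b[OF True] by (intro mult_mono) auto
    then show ?thesis by (simp add: norm_mult)
  next
    case False
    then show ?thesis using v by (auto simp: bounded_supported_def)
  qed
  then show ?thesis
    using v h by (auto simp: bounded_supported_def intro!: borel_measurable_times)
qed

lemma bounded_supported_square:
  assumes "bounded_supported v"
  shows "bounded_supported (\<lambda>x. v x * cnj (v x))"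
proof -
  obtain C where "\<And>x. norm (v x) \<le> C"
    using assms by (auto simp: bounded_supported_def)
  then show ?thesis
    using assms bounded_supported_measurable[OF assms]
    by (intro bounded_supported_mult[where C = C]) auto
qed

lemma bounded_supported_cis:
  "bounded_supported v \<Longrightarrow> bounded_supported (\<lambda>x. v x * cis (a * x))"
  by (rule bounded_supported_mult[where C = 1]) auto

lemma bounded_supported_integrable_cis:
  "bounded_supported v \<Longrightarrow> integrable lborel (\<lambda>x. v x * cis (a * x))"
  by (intro bounded_supported_integrable bounded_supported_cis)

text \<open>Shifting the frequency amounts to modulating the function, which is how Bessel's
  inequality on the integers reaches every shifted lattice.\<close>

lemma fourier_add:
  "fourier v (s + t) = fourier (\<lambda>x. v x * cis (2 * pi * s * x)) t"
  unfolding fourier_def by (intro Bochner_Integration.integral_cong) (auto simp: cis_mult algebra_simps)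

lemma has_vector_derivative_cis_linear:
  "((\<lambda>x. cis (a * x)) has_vector_derivative \<i> * of_real a * cis (a * x)) (at x within S)"
  using exp_scaleR_has_vector_derivative_right[of "\<i> * of_real a" x S]
  by (simp add: cis_conv_exp scaleR_conv_of_real mult_ac)

lemma integral_cis_period:
  fixes k :: int
  shows "(LINT x|lborel. indicator {-1/2..1/2} x * cis (2 * pi * of_int k * x)) = of_bool (k = 0)"
proof -
  have *: "(LINT x|lborel. indicator {-1/2..1/2} x *\<^sub>R cis (2 * pi * of_int k * x)) =
      integral {-1/2..1/2} (\<lambda>x. cis (2 * pi * of_int k * x))"
    unfolding set_lebesgue_integral_def[symmetric]
    by (intro set_borel_integral_eq_integral borel_integrable_atLeastAtMost' continuous_intros)
  have "((\<lambda>x. cis (2 * pi * of_int k * x)) has_integral of_bool (k = 0)) {-1/2..1/2::real}"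
  proof (cases "k = 0")
    case True
    have "((\<lambda>x. 1::complex) has_integral 1) {-1/2..1/2::real}"
      using has_integral_const_real[of "1::complex" "-1/2" "1/2"] by simp
    then show ?thesis using True by simp
  next
    case False
    define F where "F = (\<lambda>x::real. cis (2 * pi * of_int k * x) / (2 * pi * of_int k * \<i>))"
    have "((\<lambda>x. cis (2 * pi * of_int k * x)) has_integral (F (1/2) - F (-1/2))) {-1/2..1/2::real}"
    proof (rule fundamental_theorem_of_calculus)
      fix x :: real
      show "(F has_vector_derivative cis (2 * pi * of_int k * x)) (at x within {-1/2..1/2})"
        using has_vector_derivative_divide[OF has_vector_derivative_cis_linear[of "2 * pi * of_int k" x],
            where a = "of_real (2 * pi * of_int k) * \<i>"] False
        unfolding F_def by simp
    qed simp
    moreover have "cis (pi * of_int k) = cis (- (pi * of_int k))"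
      by (simp add: complex_eq_iff)
    ultimately show ?thesis using False by (simp add: F_def)
  qed
  moreover have "(\<lambda>x. indicator {-1/2..1/2} x * cis (2 * pi * of_int k * x)) =
      (\<lambda>x. indicator {-1/2..1/2} x *\<^sub>R cis (2 * pi * of_int k * x))"
    by (auto simp: fun_eq_iff indicator_def)
  ultimately show ?thesis using * by (simp add: integral_unique)
qed

text \<open>With \<open>P\<close> the projection onto the span of the characters in
  \<open>K\<close>, the mixed term and the squared norm of \<open>P\<close> both equal the left-hand
  sum. The claim is then the nonnegativity of the squared distance from \<open>v\<close> to
  \<open>P\<close>.\<close>

lemma bessel_inequality:
  assumes v: "bounded_supported v" and K: "finite K"
  shows "(\<Sum>k\<in>K. (cmod (fourier v (of_int k)))\<^sup>2) \<le> (LINT x|lborel. (cmod (v x))\<^sup>2)"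
proof -
  \<comment> \<open>The minus sign offsets the sign convention of \<open>fourier\<close>: the
    coefficient of \<open>v\<close> against \<open>e k\<close> is
    \<open>fourier v (of_int k)\<close>.\<close>
  define e where "e k x = indicator {-1/2..1/2} x * cis (- (2 * pi * of_int k) * x)" for k :: int and x :: real
  define P where "P x = (\<Sum>k\<in>K. fourier v (of_int k) * e k x)" for x
  have vm [measurable]: "v \<in> borel_measurable borel"
    using v by (simp add: bounded_supported_def)
  have ebs: "bounded_supported (e k)" for k
    unfolding e_def bounded_supported_def by (auto simp: norm_mult indicator_def intro!: exI[of _ 1])
  have em [measurable]: "e k \<in> borel_measurable borel" for k
    using ebs by (simp add: bounded_supported_def)
  have e1: "norm (e k x) \<le> 1" for k x
    unfolding e_def by (simp add: norm_mult indicator_def)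
  have Ie: "integrable lborel (\<lambda>x. v x * cnj (e k x))" if "bounded_supported v" for v k
    by (intro bounded_supported_integrable bounded_supported_mult[where C = 1])
       (use that e1 in \<open>auto simp: \<close>)
  have ve: "v x * cnj (e k x) = v x * cis (2 * pi * of_int k * x)" for k x
    using v by (auto simp: bounded_supported_def e_def indicator_def cis_cnj)
  have ee: "e l x * cnj (e k x) = indicator {-1/2..1/2} x * cis (2 * pi * of_int (k - l) * x)" for k l x
    by (auto simp: e_def indicator_def cis_cnj cis_mult algebra_simps)
  have I1: "(LINT x|lborel. v x * cnj (e k x)) = fourier v (of_int k)" for k
    by (simp add: ve fourier_def)
  have I2: "(LINT x|lborel. e l x * cnj (e k x)) = of_bool (k = l)" for k l
    unfolding ee integral_cis_period by simp
  have I3: "integrable lborel (\<lambda>x. P x * cnj (e k x))" for k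
    unfolding P_def sum_distrib_right using Ie[OF ebs]
    by (auto simp: mult.assoc intro!: Bochner_Integration.integrable_sum)
  have I4: "(LINT x|lborel. P x * cnj (e k x)) = fourier v (of_int k)" if "k \<in> K" for k
    unfolding P_def sum_distrib_right using Ie[OF ebs] K that
    by (subst Bochner_Integration.integral_sum) (auto simp: mult.assoc I2 if_distrib of_bool_def cong: if_cong)
  let ?S = "\<Sum>k\<in>K. (cmod (fourier v (of_int k)))\<^sup>2"
  have cP: "cnj (P x) = (\<Sum>k\<in>K. cnj (fourier v (of_int k)) * cnj (e k x))" for x
    by (simp add: P_def)
  have vP: "v x * cnj (P x) = (\<Sum>k\<in>K. cnj (fourier v (of_int k)) * (v x * cnj (e k x)))" for x
    by (simp add: cP sum_distrib_left mult_ac)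
  have PP: "P x * cnj (P x) = (\<Sum>k\<in>K. cnj (fourier v (of_int k)) * (P x * cnj (e k x)))" for x
    by (simp add: cP sum_distrib_left mult_ac)
  have J1: "has_bochner_integral lborel (\<lambda>x. v x * cnj (P x)) (of_real ?S)"
    unfolding has_bochner_integral_iff vP using Ie[OF v]
    by (simp add: I1 complex_norm_square mult.commute del: of_real_power)
  have J2: "has_bochner_integral lborel (\<lambda>x. P x * cnj (P x)) (of_real ?S)"
    unfolding has_bochner_integral_iff PP using I3
    by (simp add: I4 complex_norm_square mult.commute del: of_real_power)
  have J0: "integrable lborel (\<lambda>x. (cmod (v x))\<^sup>2)"
    using bounded_supported_integrable[OF bounded_supported_square[OF v]]
    by (simp add: complex_of_real_integrable_eq flip: complex_norm_square of_real_power)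
  have K1: "has_bochner_integral lborel (\<lambda>x. Re (v x * cnj (P x))) ?S"
    using has_bochner_integral_bounded_linear[OF bounded_linear_Re J1] by (simp only: Re_complex_of_real)
  have K2: "has_bochner_integral lborel (\<lambda>x. Re (P x * cnj (P x))) ?S"
    using has_bochner_integral_bounded_linear[OF bounded_linear_Re J2] by (simp only: Re_complex_of_real)
  have "0 \<le> (LINT x|lborel. (cmod (v x - P x))\<^sup>2)"
    by (intro Bochner_Integration.integral_nonneg) auto
  also have "(\<lambda>x. (cmod (v x - P x))\<^sup>2) =
      (\<lambda>x. (cmod (v x))\<^sup>2 - 2 * Re (v x * cnj (P x)) + Re (P x * cnj (P x)))"
    unfolding cmod_power2 by (auto simp: fun_eq_iff power2_eq_square algebra_simps)
  also have "(LINT x|lborel. \<dots> x) = (LINT x|lborel. (cmod (v x))\<^sup>2) - 2 * ?S + ?S"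
    by (intro has_bochner_integral_integral_eq has_bochner_integral_add has_bochner_integral_diff
        has_bochner_integral_mult_right K1 K2 has_bochner_integral_integrable J0)
  finally show ?thesis by simp
qed

section \<open>Differentiability and square integrability of the transform\<close>

lemma fourier_has_vector_derivative:
  assumes v: "bounded_supported v"
  shows "(fourier v has_vector_derivative fourier (\<lambda>x. v x * (2 * pi * \<i> * x)) t) (at t)"
proof -
  obtain C where C: "\<And>x. norm (v x) \<le> C"
    using v by (auto simp: bounded_supported_def)
  define v' where "v' = (\<lambda>x. v x * (2 * pi * \<i> * x))"
  have v': "bounded_supported v'"
    unfolding v'_def
    by (rule bounded_supported_mult[where C = pi]) (use v in \<open>auto simp: norm_mult\<close>)
  have Iv: "integrable lborel (\<lambda>x. v x * cis (2 * pi * t * x))"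
      "integrable lborel (\<lambda>x. v' x * cis (2 * pi * t * x))" for t
    using v v' by (auto intro!: bounded_supported_integrable_cis)
  \<comment> \<open>Second-order Taylor remainder of the integrand. With
    \<open>y = 2 pi (s - t) x\<close> and \<open>|2 x| <= 1\<close> on the support,
    \<open>y^2 / 2 <= (pi (s - t))^2\<close> uniformly in \<open>x\<close>.\<close>
  have bound: "norm (v x * cis (2 * pi * s * x) - v x * cis (2 * pi * t * x) - (s - t) *\<^sub>R (v' x * cis (2 * pi * t * x)))
      \<le> indicator {-1/2..1/2} x * (C * (pi * (s - t))\<^sup>2)" for s x
  proof (cases "x \<in> {-1/2..1/2}")
    case True
    define y where "y = 2 * pi * (s - t) * x"
    have "cis (2 * pi * s * x) = cis (2 * pi * t * x) * cis y"
      unfolding cis_mult y_def by (simp add: algebra_simps)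
    then have eq: "v x * cis (2 * pi * s * x) - v x * cis (2 * pi * t * x) - (s - t) *\<^sub>R (v' x * cis (2 * pi * t * x))
      = v x * cis (2 * pi * t * x) * (cis y - (1 + \<i> * y))"
      by (simp add: y_def v'_def scaleR_conv_of_real algebra_simps)
    have y1: "norm (cis y - (1 + \<i> * y)) \<le> y\<^sup>2 / 2"
      using iexp_approx1[of y 1] by (simp add: cis_conv_exp power2_eq_square)
    have "(2 * x)\<^sup>2 \<le> 1"
      using True by (intro abs_square_le_1[THEN iffD2]) auto
    then have "(pi * (s - t))\<^sup>2 * (2 * x)\<^sup>2 / 2 \<le> (pi * (s - t))\<^sup>2 * 1 / 2"
      by (intro divide_right_mono mult_left_mono) auto
    moreover have "y\<^sup>2 = (pi * (s - t))\<^sup>2 * (2 * x)\<^sup>2"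
      by (simp only: y_def power_mult_distrib[symmetric]) (simp only: mult_ac)
    ultimately have "y\<^sup>2 / 2 \<le> (pi * (s - t))\<^sup>2"
      using zero_le_power2[of "pi * (s - t)"] by linarith
    with y1 have y2: "norm (cis y - (1 + \<i> * y)) \<le> (pi * (s - t))\<^sup>2"
      by (rule order_trans)
    have "norm (v x * cis (2 * pi * s * x) - v x * cis (2 * pi * t * x) - (s - t) *\<^sub>R (v' x * cis (2 * pi * t * x)))
        \<le> norm (v x) * (pi * (s - t))\<^sup>2"
      unfolding eq norm_mult using mult_left_mono[OF y2, of "norm (v x)"] by simp
    also have "\<dots> \<le> C * (pi * (s - t))\<^sup>2"
      by (intro mult_right_mono C) auto
    finally show ?thesis using True by simp
  next
    case False
    then show ?thesis using v by (auto simp: v'_def bounded_supported_def)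
  qed
  have key: "norm (fourier v s - fourier v t - (s - t) *\<^sub>R fourier v' t) \<le> C * pi\<^sup>2 * (s - t)\<^sup>2" for s
  proof -
    have "norm (fourier v s - fourier v t - (s - t) *\<^sub>R fourier v' t) = norm (LINT x|lborel. v x * cis (2 * pi * s * x) -
        v x * cis (2 * pi * t * x) - (s - t) *\<^sub>R (v' x * cis (2 * pi * t * x)))"
      unfolding fourier_def using Iv by simp
    also have " \<dots> \<le> (LINT x|lborel. indicator {-1/2..1/2::real} x * (C * (pi * (s - t))\<^sup>2))"
    proof (rule Bochner_Integration.integral_norm_bound_integral)
      show "integrable lborel (\<lambda>x. v x * cis (2 * pi * s * x) -
        v x * cis (2 * pi * t * x) - (s - t) *\<^sub>R (v' x * cis (2 * pi * t * x)))"
        by (intro Bochner_Integration.integrable_diff Bochner_Integration.integrable_scaleR_right Iv)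
    qed (simp, rule bound)
    also have "\<dots> = C * pi\<^sup>2 * (s - t)\<^sup>2"
      by (simp add: power_mult_distrib)
    finally show ?thesis .
  qed
  have "(fourier v has_vector_derivative fourier v' t) (at t)"
    unfolding has_vector_derivative_def has_derivative_at_alt
  proof (intro conjI allI impI bounded_linear_scaleR_left)
    fix e :: real assume e: "e > 0"
    \<comment> \<open>The summand 1 keeps the denominator positive even when
      \<open>C = 0\<close>.\<close>
    define d where "d = e / (\<bar>C\<bar> * pi\<^sup>2 + 1)"
    have D: "\<bar>C\<bar> * pi\<^sup>2 + 1 > 0" by (intro add_nonneg_pos) auto
    have "norm (fourier v s - fourier v t - (s - t) *\<^sub>R fourier v' t) \<le> e * norm (s - t)" if "norm (s - t) < d" for s
    proof -
      have "C * pi\<^sup>2 * \<bar>s - t\<bar> \<le> (\<bar>C\<bar> * pi\<^sup>2 + 1) * d"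
        using that by (intro mult_mono) (auto intro: order_trans[of _ "\<bar>C\<bar> * pi\<^sup>2"] mult_right_mono)
      also have "\<dots> = e" using D by (simp add: d_def)
      finally have "C * pi\<^sup>2 * \<bar>s - t\<bar> * \<bar>s - t\<bar> \<le> e * \<bar>s - t\<bar>"
        by (intro mult_right_mono) auto
      then show ?thesis using key[of s] by (simp add: power2_eq_square mult.assoc)
    qed
    then show "\<exists>d>0. \<forall>y. norm (y - t) < d \<longrightarrow> norm (fourier v y - fourier v t - (y - t) *\<^sub>R fourier v' t) \<le> e * norm (y - t)"
      using e D by (intro exI[of _ d]) (auto simp: d_def)
  qed
  then show ?thesis by (simp add: v'_def)
qed

lemma continuous_on_fourier: "bounded_supported v \<Longrightarrow> continuous_on S (fourier v)"
  using fourier_has_vector_derivative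
  by (meson continuous_at_imp_continuous_on has_vector_derivative_continuous)

lemma bounded_supported_moment:
  "bounded_supported v \<Longrightarrow> bounded_supported (\<lambda>x. v x * (2 * pi * \<i> * x))"
  by (rule bounded_supported_mult[where C = pi]) (auto simp: norm_mult)

text \<open>Averaging Bessel's inequality over all shifts of the integer lattice of frequencies gives the
  half of Plancherel's theorem that is needed.\<close>

lemma fourier_square_integrable:
  assumes v: "bounded_supported v"
  shows "integrable lborel (\<lambda>t. (cmod (fourier v t))\<^sup>2)"
proof -
  define A where "A = (LINT x|lborel. (cmod (v x))\<^sup>2)"
  let ?g = "\<lambda>t. (cmod (fourier v t))\<^sup>2"
  have cont: "continuous_on S ?g" for S
    by (intro continuous_intros continuous_on_fourier v)
  have gi: "?g integrable_on {a..b}" for a b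
    by (intro integrable_continuous_interval cont)
  have shift: "integral {real_of_int k..real_of_int k + 1} ?g = integral {0..1} (\<lambda>s. ?g (s + of_int k))" for k
    using integral_shift_real_ivl[of "of_int k" "of_int k" "of_int k + 1" ?g] by simp
  have split: "integral {- real n..real n} ?g = (\<Sum>k\<in>{- int n..<int n}. integral {real_of_int k..real_of_int k + 1} ?g)" for n
  proof (induction n)
    case (Suc n)
    have "{- int (Suc n)..<int (Suc n)} = insert (- int (Suc n)) (insert (int n) {- int n..<int n})"
      by auto
    moreover have "integral {- real (Suc n)..real (Suc n)} ?g =
        integral {- real (Suc n)..- real n} ?g + integral {- real n..real n} ?g + integral {real n..real (Suc n)} ?g"
      using Henstock_Kurzweil_Integration.integral_combine[OF _ _ gi, of "- real (Suc n)" "- real n" "real n"]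
        Henstock_Kurzweil_Integration.integral_combine[OF _ _ gi, of "- real (Suc n)" "real n" "real (Suc n)"]
      by simp
    ultimately show ?case using Suc by (simp add: add.commute)
  qed simp
  \<comment> \<open>Folding the unit intervals onto \<open>[0, 1]\<close> leaves, for each
    \<open>s\<close>, a sum over a shifted lattice. Modulation by \<open>s\<close> preserves
    \<open>cmod (v x)\<close>, so Bessel's inequality bounds this sum by the same
    \<open>A\<close>.\<close>
  have le: "integral {- real n..real n} ?g \<le> A" for n
  proof -
    have gi': "(\<lambda>s. ?g (s + of_int k)) integrable_on {0..1}" for k
      by (intro integrable_continuous_interval continuous_intros
          continuous_on_compose2[OF continuous_on_fourier[OF v, of UNIV]]) auto
    have "integral {- real n..real n} ?g = integral {0..1} (\<lambda>s. \<Sum>k\<in>{- int n..<int n}. ?g (s + of_int k))"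
      unfolding split shift using gi' by (subst integral_sum) auto
    also have "\<dots> \<le> integral {0..1::real} (\<lambda>s. A)"
    proof (rule Henstock_Kurzweil_Integration.integral_le)
      fix s :: real assume "s \<in> {0..1}"
      show "(\<Sum>k\<in>{- int n..<int n}. ?g (s + of_int k)) \<le> A"
        using bessel_inequality[OF bounded_supported_cis[OF v, of "2 * pi * s"], of "{- int n..<int n}"]
        by (simp add: fourier_add A_def norm_mult)
    qed (auto intro!: Henstock_Kurzweil_Integration.integrable_sum gi')
    finally show ?thesis by simp
  qed
  have meas [measurable]: "?g \<in> borel_measurable borel"
    by (intro borel_measurable_continuous_onI cont)
  have "(\<integral>\<^sup>+t. ennreal (?g t) \<partial>lborel) = (SUP n. \<integral>\<^sup>+t. ennreal (?g t) * indicator {- real n..real n} t \<partial>lborel)"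
  proof (subst nn_integral_monotone_convergence_SUP[symmetric])
    show "(\<integral>\<^sup>+t. ennreal (?g t) \<partial>lborel) = (\<integral>\<^sup>+t. (SUP n. ennreal (?g t) * indicator {- real n..real n} t) \<partial>lborel)"
    proof (rule nn_integral_cong)
      fix t :: real
      obtain n where n: "\<bar>t\<bar> \<le> real n" using real_arch_simple by blast
      have "(SUP n. ennreal (?g t) * indicator {- real n..real n} t) = ennreal (?g t)"
      proof (rule antisym)
        show "ennreal (?g t) \<le> (SUP n. ennreal (?g t) * indicator {- real n..real n} t)"
          by (rule SUP_upper2[of n]) (use n in \<open>auto simp: abs_le_iff\<close>)
      qed (auto intro!: SUP_least simp: indicator_def)
      then show "ennreal (?g t) = (SUP n. ennreal (?g t) * indicator {- real n..real n} t)" by simp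
    qed
  qed (auto simp: incseq_def le_fun_def indicator_def)
  also have "\<dots> \<le> ennreal A"
  proof (rule SUP_least)
    fix n
    have "(?g has_integral integral {- real n..real n} ?g) {- real n..real n}"
      using gi by (rule integrable_integral)
    then have "(\<integral>\<^sup>+t. ennreal (?g t) * indicator {- real n..real n} t \<partial>lborel) = ennreal (integral {- real n..real n} ?g)"
      by (intro nn_integral_has_integral_lebesgue') auto
    then show "(\<integral>\<^sup>+t. ennreal (?g t) * indicator {- real n..real n} t \<partial>lborel) \<le> ennreal A"
      using le[of n] by (simp add: ennreal_leI)
  qed
  finally show ?thesis
    by (intro integrableI_nonneg) (auto simp: less_top[symmetric] top_unique)
qed

section \<open>Riemann sums of integrable functions with integrable derivative\<close>

text \<open>Each cell contributes at most \<open>\<nu> * \<integral>norm F'\<close> to the error of the Riemann sum, because \<open>F s\<close> and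
  \<open>F u\<close> differ by at most \<open>\<integral>norm F'\<close> over the cell.\<close>

lemma cell_error:
  fixes F F' :: "real \<Rightarrow> complex"
  assumes d: "\<And>t. (F has_vector_derivative F' t) (at t)" and c: "continuous_on UNIV F'"
    and s: "a \<le> s" "s \<le> b"
  shows "norm (of_real (b - a) * F s - integral {a..b} F) \<le> (b - a) * integral {a..b} (\<lambda>t. norm (F' t))"
proof -
  have Fc: "continuous_on S F" for S
    using d by (meson continuous_at_imp_continuous_on has_vector_derivative_continuous)
  have F'c: "continuous_on S F'" for S
    using c continuous_on_subset by blast
  have Ni: "(\<lambda>t. norm (F' t)) integrable_on {c..d}" for c d
    by (intro integrable_continuous_interval continuous_intros F'c)
  have *: "norm (F v - F u) \<le> integral {a..b} (\<lambda>t. norm (F' t))" if "a \<le> u" "u \<le> v" "v \<le> b" for u v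
  proof -
    have "(F' has_integral (F v - F u)) {u..v}"
      using that d by (intro fundamental_theorem_of_calculus) (auto intro: has_vector_derivative_at_within)
    then have "norm (F v - F u) \<le> integral {u..v} (\<lambda>t. norm (F' t))"
      by (metis Ni F'c integrable_continuous_interval integral_norm_bound_integral integral_unique order_refl)
    also have "\<dots> \<le> integral {a..b} (\<lambda>t. norm (F' t))"
      using that by (intro integral_subset_le Ni) auto
    finally show ?thesis .
  qed
  have **: "norm (F s - F u) \<le> integral {a..b} (\<lambda>t. norm (F' t))" if "u \<in> {a..b}" for u
    using *[of u s] *[of s u] that s by (cases "u \<le> s") (auto simp: norm_minus_commute)
  have "of_real (b - a) * F s - integral {a..b} F = integral {a..b} (\<lambda>u. F s - F u)"
    using s by (subst Henstock_Kurzweil_Integration.integral_diff)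
       (auto intro!: integrable_continuous_interval Fc simp: scaleR_conv_of_real)
  also have "norm \<dots> \<le> integral {a..b} (\<lambda>u. integral {a..b} (\<lambda>t. norm (F' t)))"
    by (intro integral_norm_bound_integral integrable_continuous_interval continuous_intros Fc) (use ** in auto)
  also have "\<dots> = (b - a) * integral {a..b} (\<lambda>t. norm (F' t))"
    using s by simp
  finally show ?thesis .
qed

section \<open>Integrable functions over growing and escaping intervals\<close>

lemma integral_le_lborel:
  fixes g :: "real \<Rightarrow> real"
  assumes "integrable lborel g" "\<And>t. 0 \<le> g t" "continuous_on UNIV g"
  shows "integral {a..b} g \<le> (LINT t|lborel. g t)"
proof -
  have "(g has_integral (LINT t|lborel. g t)) UNIV"
    by (rule has_integral_integral_lborel) fact
  moreover have "g integrable_on {a..b}"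
    using assms(3) by (meson continuous_on_subset integrable_continuous_interval subset_UNIV)
  ultimately show ?thesis
    using integral_subset_le[of "{a..b}" UNIV g] assms(2) by (auto simp: integral_unique)
qed

lemma integral_tendsto_lborel:
  fixes F :: "real \<Rightarrow> complex"
  assumes F: "integrable lborel F" and c: "continuous_on UNIV F"
  shows "((\<lambda>T. integral {-T..T} F) \<longlongrightarrow> (LINT t|lborel. F t)) at_top"
proof -
  have eq: "(LINT t|lborel. indicator {-T..T} t *\<^sub>R F t) = integral {-T..T} F" for T
    unfolding set_lebesgue_integral_def[symmetric]
    by (intro set_borel_integral_eq_integral borel_integrable_atLeastAtMost' continuous_on_subset[OF c]) auto
  have "((\<lambda>T. LINT t|lborel. indicator {-T..T} t *\<^sub>R F t) \<longlongrightarrow> (LINT t|lborel. F t)) at_top"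
  proof (rule integral_dominated_convergence_at_top)
    show "AE t in lborel. ((\<lambda>T. indicator {-T..T} t *\<^sub>R F t) \<longlongrightarrow> F t) at_top"
    proof (rule AE_I2)
      fix t :: real
      have "\<forall>\<^sub>F T in at_top. indicator {-T..T} t *\<^sub>R F t = F t"
        using eventually_ge_at_top[of "\<bar>t\<bar>"] by eventually_elim (auto simp: indicator_def)
      then show "((\<lambda>T. indicator {-T..T} t *\<^sub>R F t) \<longlongrightarrow> F t) at_top"
        by (rule tendsto_eventually)
    qed
    show "integrable lborel (\<lambda>t. norm (F t))" using F by simp
  qed (use F in \<open>auto simp: indicator_def intro!: always_eventually\<close>)
  then show ?thesis by (simp only: eq)
qed

text \<open>The window eventually leaves every fixed point, so the integrand tends to 0 pointwise
  and \<open>norm (g t)\<close> dominates it.\<close>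

lemma integral_window_tendsto_0:
  fixes g :: "real \<Rightarrow> real"
  assumes g: "integrable lborel g" and c: "continuous_on UNIV g"
  shows "((\<lambda>T. integral {T..T + 1} g) \<longlongrightarrow> 0) at_top"
proof -
  have eq: "(LINT t|lborel. indicator {T..T + 1} t *\<^sub>R g t) = integral {T..T + 1} g" for T
    unfolding set_lebesgue_integral_def[symmetric]
    by (intro set_borel_integral_eq_integral borel_integrable_atLeastAtMost' continuous_on_subset[OF c]) auto
  have "((\<lambda>T. LINT t|lborel. indicator {T..T + 1} t *\<^sub>R g t) \<longlongrightarrow> (LINT t|(lborel :: real measure). 0 :: real)) at_top"
  proof (rule integral_dominated_convergence_at_top[where f = "\<lambda>_. 0" and w = "\<lambda>t. norm (g t)"])
    show "AE t in lborel. ((\<lambda>T. indicator {T..T + 1} t *\<^sub>R g t) \<longlongrightarrow> 0) at_top"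
    proof (rule AE_I2)
      fix t :: real
      have "\<forall>\<^sub>F T in at_top. indicator {T..T + 1} t *\<^sub>R g t = 0"
        using eventually_gt_at_top[of t] by eventually_elim (auto simp: indicator_def)
      then show "((\<lambda>T. indicator {T..T + 1} t *\<^sub>R g t) \<longlongrightarrow> 0) at_top"
        by (rule tendsto_eventually)
    qed
    show "integrable lborel (\<lambda>t. norm (g t))" using g by simp
  qed (use g in \<open>auto simp: indicator_def intro!: always_eventually\<close>)
  then show ?thesis by (simp only: eq) simp
qed

text \<open>Integrability of \<open>F'\<close> bounds the total cell error, and integrability of
  \<open>F\<close> provides the limit. The instances are
  \<open>(fourier v t)\<^sup>2 * K (fourier v t)\<close>, with constant \<open>K\<close> for the
  Riemann-Lebesgue lemma.\<close>

locale integrable_C1 =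
  fixes F F' :: "real \<Rightarrow> complex"
  assumes deriv: "\<And>t. (F has_vector_derivative F' t) (at t)" and cont': "continuous_on UNIV F'"
    and int: "integrable lborel F" and int': "integrable lborel F'"
begin

lemma cont: "continuous_on S F"
  using deriv by (meson continuous_at_imp_continuous_on has_vector_derivative_continuous)

text \<open>\<open>F T\<close> differs from its mean over \<open>[T, T + 1]\<close> by at most the
  integral of \<open>norm (F' t)\<close> there, and both window integrals vanish in the
  limit.\<close>

lemma tendsto_0_at_top: "(F \<longlongrightarrow> 0) at_top"
proof (rule Lim_null_comparison)
  show "\<forall>\<^sub>F T in at_top. norm (F T) \<le> integral {T..T + 1} (\<lambda>t. norm (F' t)) + integral {T..T + 1} (\<lambda>t. norm (F t))"
  proof (rule always_eventually, rule allI)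
    fix T
    have "norm (F T - integral {T..T + 1} F) \<le> integral {T..T + 1} (\<lambda>t. norm (F' t))"
      using cell_error[OF deriv cont', of T T "T + 1"] by simp
    moreover have "norm (integral {T..T + 1} F) \<le> integral {T..T + 1} (\<lambda>t. norm (F t))"
      by (intro integral_norm_bound_integral integrable_continuous_interval continuous_intros cont) auto
    ultimately show "norm (F T) \<le> integral {T..T + 1} (\<lambda>t. norm (F' t)) + integral {T..T + 1} (\<lambda>t. norm (F t))"
      using norm_triangle_sub[of "F T" "integral {T..T + 1} F"] by linarith
  qed
  show "((\<lambda>T. integral {T..T + 1} (\<lambda>t. norm (F' t)) + integral {T..T + 1} (\<lambda>t. norm (F t))) \<longlongrightarrow> 0) at_top"
    by (rule tendsto_eq_rhs[OF tendsto_add[OF integral_window_tendsto_0 integral_window_tendsto_0]])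
       (use int int' in \<open>auto intro!: continuous_intros cont cont'\<close>)
qed

end

text \<open>The cells are centred at the nodes \<open>k * \<nu>\<close>, so \<open>2 N + 1\<close>
  nodes match the symmetric interval of half-length \<open>(N + 1/2) * \<nu>\<close> exactly. The
  induction adds one cell at each end.\<close>

lemma integral_cells:
  fixes g :: "real \<Rightarrow> 'a :: banach"
  assumes c: "continuous_on UNIV g" and "\<nu> > 0"
  shows "integral {- ((real N + 1/2) * \<nu>)..(real N + 1/2) * \<nu>} g =
    (\<Sum>k\<in>{- int N..int N}. integral {(of_int k - 1/2) * \<nu>..(of_int k + 1/2) * \<nu>} g)"
proof (induction N)
  case (Suc N)
  let ?a = "(real N + 1/2) * \<nu>" and ?b = "(real (Suc N) + 1/2) * \<nu>"
  have gi: "g integrable_on {a..b}" for a b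
    using c by (meson continuous_on_subset integrable_continuous_interval subset_UNIV)
  have le: "- ?b \<le> - ?a" "- ?a \<le> ?a" "?a \<le> ?b" "- ?b \<le> ?a"
    using \<open>\<nu> > 0\<close> by (auto simp: algebra_simps intro: order_trans[of _ 0])
  let ?I = "\<lambda>k. integral {(real_of_int k - 1/2) * \<nu>..(of_int k + 1/2) * \<nu>} g"
  have "{- int (Suc N)..int (Suc N)} = insert (- int (Suc N)) (insert (int (Suc N)) {- int N..int N})"
    by auto
  then have "sum ?I {- int (Suc N)..int (Suc N)} = ?I (- int (Suc N)) + (?I (int (Suc N)) + sum ?I {- int N..int N})"
    by simp
  moreover have "integral {- ?b..?b} g = integral {- ?b..- ?a} g + integral {- ?a..?a} g + integral {?a..?b} g"
    using Henstock_Kurzweil_Integration.integral_combine[OF le(1,2) gi]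
      Henstock_Kurzweil_Integration.integral_combine[OF le(4,3) gi] by simp
  moreover have eqs: "(real_of_int (- int (Suc N)) - 1/2) * \<nu> = - ?b" "(real_of_int (- int (Suc N)) + 1/2) * \<nu> = - ?a"
    "(real_of_int (int (Suc N)) - 1/2) * \<nu> = ?a" "(real_of_int (int (Suc N)) + 1/2) * \<nu> = ?b"
    by (auto simp: algebra_simps)
  ultimately show ?case
    using Suc unfolding eqs by (simp only: add_ac)
qed simp

context integrable_C1
begin

text \<open>The cell errors add up to at most the full integral of \<open>norm (F' t)\<close> times
  \<open>\<nu>\<close>, independently of \<open>N\<close>, so the bound survives the passage to the
  infinite sum.\<close>

lemma riemann_sum_error:
  assumes "\<nu> > 0"
  shows "norm (of_real \<nu> * (\<Sum>k\<in>{- int N..int N}. F (of_int k * \<nu>)) -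
      integral {- ((real N + 1/2) * \<nu>)..(real N + 1/2) * \<nu>} F) \<le> \<nu> * (LINT t|lborel. norm (F' t))"
proof -
  let ?l = "\<lambda>k. (real_of_int k - 1/2) * \<nu>" and ?r = "\<lambda>k. (real_of_int k + 1/2) * \<nu>"
  have "norm (of_real \<nu> * (\<Sum>k\<in>{- int N..int N}. F (of_int k * \<nu>)) -
      integral {- ((real N + 1/2) * \<nu>)..(real N + 1/2) * \<nu>} F)
    = norm (\<Sum>k\<in>{- int N..int N}. of_real \<nu> * F (of_int k * \<nu>) - integral {?l k..?r k} F)"
    by (simp add: integral_cells[OF cont assms] sum_distrib_left sum_subtractf)
  also have "\<dots> \<le> (\<Sum>k\<in>{- int N..int N}. \<nu> * integral {?l k..?r k} (\<lambda>t. norm (F' t)))"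
  proof (rule sum_norm_le)
    fix k
    have "?r k - ?l k = \<nu>" by (simp add: algebra_simps)
    then show "norm (of_real \<nu> * F (of_int k * \<nu>) - integral {?l k..?r k} F) \<le> \<nu> * integral {?l k..?r k} (\<lambda>t. norm (F' t))"
      using cell_error[OF deriv cont', of "?l k" "of_int k * \<nu>" "?r k"] assms by (simp add: algebra_simps)
  qed
  also have "\<dots> = \<nu> * integral {- ((real N + 1/2) * \<nu>)..(real N + 1/2) * \<nu>} (\<lambda>t. norm (F' t))"
    by (simp add: integral_cells[OF continuous_on_norm[OF cont'] assms] sum_distrib_left)
  also have "\<dots> \<le> \<nu> * (LINT t|lborel. norm (F' t))"
    using assms int' by (intro mult_left_mono integral_le_lborel continuous_intros cont') auto
  finally show ?thesis .
qed


lemma symmetric_integral_tendsto: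
  "((\<lambda>T. integral {-T..T} F) \<longlongrightarrow> (LINT t|lborel. F t)) at_top"
  by (rule integral_tendsto_lborel[OF int cont])

text \<open>The cell estimate for norms makes the series absolutely summable, so the symmetric sums
  converge; the error bound, uniform in \<open>N\<close>, then passes to the limit.\<close>

lemma riemann_sum_limit:
  assumes \<nu>: "\<nu> > 0"
  obtains s where "(\<lambda>N. of_real \<nu> * (\<Sum>k\<in>{- int N..int N}. F (of_int k * \<nu>))) \<longlonglongrightarrow> s"
    "norm (s - (LINT t|lborel. F t)) \<le> \<nu> * (LINT t|lborel. norm (F' t))"
proof -
  have cell: "\<nu> * norm (F (of_int k * \<nu>)) \<le>
      \<nu> * integral {(of_int k - 1/2) * \<nu>..(of_int k + 1/2) * \<nu>} (\<lambda>t. norm (F' t)) +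
      integral {(of_int k - 1/2) * \<nu>..(of_int k + 1/2) * \<nu>} (\<lambda>t. norm (F t))" (is "_ \<le> \<nu> * ?A + ?B") for k :: int
  proof -
    let ?l = "(of_int k - 1/2) * \<nu>" and ?r = "(of_int k + 1/2) * \<nu>"
    have "?r - ?l = \<nu>" by (simp add: algebra_simps)
    then have "norm (of_real \<nu> * F (of_int k * \<nu>) - integral {?l..?r} F) \<le> \<nu> * ?A"
      using cell_error[OF deriv cont', of ?l "of_int k * \<nu>" ?r] \<nu> by (simp add: algebra_simps)
    moreover have "norm (integral {?l..?r} F) \<le> ?B"
      by (intro integral_norm_bound_integral integrable_continuous_interval continuous_intros cont) auto
    ultimately show ?thesis
      using norm_triangle_sub[of "of_real \<nu> * F (of_int k * \<nu>)" "integral {?l..?r} F"] \<nu> by (simp add: norm_mult)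
  qed
  \<comment> \<open>Pairing \<open>k\<close> with \<open>-k\<close> turns the symmetric sum into a
    one-sided series; \<open>k = 0\<close> stands alone so that \<open>F 0\<close> is counted
    once.\<close>
  define a where "a k = (if k = 0 then F 0 else F (of_nat k * \<nu>) + F (- of_nat k * \<nu>))" for k :: nat
  define b where "b k = (if k = 0 then norm (F 0) else norm (F (of_nat k * \<nu>)) + norm (F (- of_nat k * \<nu>)))" for k :: nat
  \<comment> \<open>Stated for any normed target, since it serves both the complex series and the
    real series of norms.\<close>
  have fold: "(\<Sum>k\<in>{- int N..int N}. h (of_int k * \<nu>)) =
      (\<Sum>k\<le>N. if k = 0 then h 0 else h (of_nat k * \<nu>) + h (- of_nat k * \<nu>))" for h :: "real \<Rightarrow> 'b :: real_normed_vector" and N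
  proof (induction N)
    case (Suc N)
    have "{- int (Suc N)..int (Suc N)} = insert (- int (Suc N)) (insert (int (Suc N)) {- int N..int N})"
      by auto
    then show ?case using Suc by (simp add: add_ac)
  qed simp
  \<comment> \<open>The sum of the estimates \<open>cell\<close> over all \<open>k\<close>, divided
    by \<open>\<nu>\<close>.\<close>
  define M where "M = (LINT t|lborel. norm (F' t)) + (LINT t|lborel. norm (F t)) / \<nu>"
  have "sum b {..N} \<le> M" for N
  proof -
    have "\<nu> * sum b {..N} = (\<Sum>k\<in>{- int N..int N}. \<nu> * norm (F (of_int k * \<nu>)))"
      unfolding b_def sum_distrib_left[symmetric] by (subst fold) (rule refl)
    also have "\<dots> \<le> \<nu> * integral {- ((real N + 1/2) * \<nu>)..(real N + 1/2) * \<nu>} (\<lambda>t. norm (F' t)) +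
        integral {- ((real N + 1/2) * \<nu>)..(real N + 1/2) * \<nu>} (\<lambda>t. norm (F t))"
      unfolding integral_cells[OF continuous_on_norm[OF cont'] \<nu>] integral_cells[OF continuous_on_norm[OF cont] \<nu>]
        sum_distrib_left sum.distrib[symmetric]
      by (intro sum_mono cell)
    also have "\<dots> \<le> \<nu> * (LINT t|lborel. norm (F' t)) + (LINT t|lborel. norm (F t))"
      using \<nu> int int' by (intro add_mono mult_left_mono integral_le_lborel continuous_intros cont cont') auto
    also have "\<dots> = \<nu> * M" using \<nu> by (simp add: M_def field_simps)
    finally show ?thesis using \<nu> by simp
  qed
  then have "summable b"
    by (intro bounded_imp_summable[of b M]) (auto simp: b_def)
  then have "summable a"
    by (rule summable_comparison_test'[where N = 0]) (auto simp: a_def b_def norm_triangle_ineq)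
  then have "(\<lambda>N. sum a {..N}) \<longlonglongrightarrow> suminf a"
    by (rule summable_LIMSEQ')
  then have lim: "(\<lambda>N. of_real \<nu> * (\<Sum>k\<in>{- int N..int N}. F (of_int k * \<nu>))) \<longlonglongrightarrow> of_real \<nu> * suminf a"
    unfolding fold a_def[symmetric] by (intro tendsto_intros)
  have "filterlim (\<lambda>N. (real N + 1/2) * \<nu>) at_top sequentially"
    using \<nu> by real_asymp
  then have "(\<lambda>N. integral {- ((real N + 1/2) * \<nu>)..(real N + 1/2) * \<nu>} F) \<longlonglongrightarrow> (LINT t|lborel. F t)"
    using filterlim_compose[OF symmetric_integral_tendsto] by fastforce
  from tendsto_norm[OF tendsto_diff[OF lim this]]
  have "(\<lambda>N. norm (of_real \<nu> * (\<Sum>k\<in>{- int N..int N}. F (of_int k * \<nu>)) -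
      integral {- ((real N + 1/2) * \<nu>)..(real N + 1/2) * \<nu>} F)) \<longlonglongrightarrow> norm (of_real \<nu> * suminf a - (LINT t|lborel. F t))" .
  then have "norm (of_real \<nu> * suminf a - (LINT t|lborel. F t)) \<le> \<nu> * (LINT t|lborel. norm (F' t))"
    by (rule LIMSEQ_le_const2) (use riemann_sum_error[OF \<nu>] in auto)
  with lim show ?thesis by (rule that)
qed

end

section \<open>The double contour integral as a power series\<close>

text \<open>By the Weierstrass test the partial sums converge uniformly on the circle, which permits
  termwise integration.\<close>

lemma contour_integral_circlepath_sums:
  assumes r: "0 < r"
    and h: "\<And>n. (h n has_contour_integral I n) (circlepath 0 r)"
    and bound: "\<And>n u. cmod u = r \<Longrightarrow> cmod (h n u) \<le> M n" and M: "summable M"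
    and l: "\<And>u. cmod u = r \<Longrightarrow> (\<lambda>n. h n u) sums l u"
  shows "I sums contour_integral (circlepath 0 r) l"
proof -
  have "uniform_limit (sphere 0 r) (\<lambda>n u. \<Sum>i<n. h i u) (\<lambda>u. suminf (\<lambda>i. h i u)) sequentially"
    by (rule Weierstrass_m_test[OF _ M]) (auto intro: bound)
  then have "uniform_limit (sphere 0 r) (\<lambda>n u. \<Sum>i<n. h i u) l sequentially"
    by (rule uniform_limit_cong'[THEN iffD1, rotated -1]) (auto simp: sums_unique[OF l])
  moreover have sum: "((\<lambda>u. \<Sum>i<n. h i u) has_contour_integral (\<Sum>i<n. I i)) (circlepath 0 r)" for n
    by (intro has_contour_integral_sum h) auto
  ultimately have "(\<lambda>n. contour_integral (circlepath 0 r) (\<lambda>u. \<Sum>i<n. h i u)) \<longlonglongrightarrow> contour_integral (circlepath 0 r) l"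
    using r by (intro contour_integral_uniform_limit_circlepath(2))
       (auto intro!: always_eventually has_contour_integral_integrable)
  then show ?thesis
    unfolding sums_def contour_integral_unique[OF sum] .
qed

text \<open>Since \<open>|a| < r^2 = |z u|\<close>, the kernel expands as the sum of
  \<open>(n + 1) a^(n + 1) / (z u)^(n + 2)\<close>, in which \<open>z\<close> and \<open>u\<close>
  separate. Each circle yields a Taylor coefficient by Cauchy's formula, and
  \<open>(2 pi i)^2\<close> is the factor \<open>-4 pi^2\<close>.\<close>

lemma circle_integral_sums:
  fixes f :: "complex \<Rightarrow> complex"
  defines "p \<equiv> \<lambda>m. (deriv ^^ m) f 0 / fact m"
    and "q \<equiv> \<lambda>m. (deriv ^^ m) (cnj \<circ> f \<circ> cnj) 0 / fact m"
  assumes f: "f holomorphic_on ball 0 R" and r: "0 < r" "r < R" and a: "cmod a < r\<^sup>2"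
  shows "(\<lambda>n. - of_real (4 * pi\<^sup>2) * (of_nat (Suc n) * p (Suc n) * q (Suc n) * a ^ Suc n)) sums circle_integral f r a"
proof -
  \<comment> \<open>Reflection makes the conjugated factor holomorphic in \<open>u\<close>; its
    Taylor coefficients at 0 are the conjugates of those of \<open>f\<close>.\<close>
  define g where "g = cnj \<circ> f \<circ> cnj"
  have g: "g holomorphic_on ball 0 R"
    unfolding g_def using f by (intro holomorphic_on_compose_cnj_cnj) (auto elim!: holomorphic_on_subset)
  have coeff: "((\<lambda>u. h u / u ^ Suc m) has_contour_integral (2 * pi * \<i> * ((deriv ^^ m) h 0 / fact m))) (circlepath 0 r)"
    if "h holomorphic_on ball 0 R" for h m
  proof -
    have "h holomorphic_on cball 0 r"
      using that r by (auto elim!: holomorphic_on_subset)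
    then have "continuous_on (cball 0 r) h" "h holomorphic_on ball 0 r"
      by (auto intro: holomorphic_on_imp_continuous_on holomorphic_on_subset)
    from Cauchy_has_contour_integral_higher_derivative_circlepath[OF this, of 0 m] r show ?thesis
      by simp
  qed
  have bounded: "\<exists>B>0. \<forall>u. cmod u = r \<longrightarrow> cmod (h u) \<le> B" if "h holomorphic_on ball 0 R" for h
  proof -
    have "continuous_on (sphere 0 r) h"
      using r that by (auto intro: holomorphic_on_imp_continuous_on[OF holomorphic_on_subset])
    then have "bounded (h ` sphere 0 r)"
      by (intro compact_imp_bounded compact_continuous_image) auto
    then show ?thesis by (auto simp: bounded_pos)
  qed
  obtain B where B: "B > 0" "\<And>u. cmod u = r \<Longrightarrow> cmod (f u) \<le> B" using bounded[OF f] by blast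
  obtain D where D: "D > 0" "\<And>u. cmod u = r \<Longrightarrow> cmod (g u) \<le> D" using bounded[OF g] by blast
  \<comment> \<open>The majorants are differentiated geometric series with this ratio, which is
    below 1 exactly because \<open>cmod a < r\<^sup>2\<close>.\<close>
  define x where "x = cmod a / r\<^sup>2"
  have x: "0 \<le> x" "x < 1" using a r by (auto simp: x_def)
  have sx: "summable (\<lambda>n. C * (real (Suc n) * x ^ n))" for C
    using geometric_deriv_sums[of x] x by (intro summable_mult) (auto simp: sums_iff)
  have xn: "cmod a ^ Suc n / r ^ Suc (Suc n) / r ^ Suc (Suc n) = cmod a / r ^ 4 * x ^ n" for n
    using r by (simp add: x_def power_divide field_simps power2_eq_square power_mult_distrib eval_nat_numeral)
  have inner: "(\<lambda>n. f z * of_nat (Suc n) * a ^ Suc n / z ^ Suc (Suc n) * (2 * pi * \<i> * q (Suc n))) sums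
      contour_integral (circlepath 0 r) (\<lambda>u. f z * cnj (f (cnj u)) * a / (z * u - a)\<^sup>2)" if z: "cmod z = r" for z
  proof (rule contour_integral_circlepath_sums[OF r(1)])
    show "((\<lambda>u. f z * of_nat (Suc n) * a ^ Suc n / z ^ Suc (Suc n) * (g u / u ^ Suc (Suc n))) has_contour_integral
      f z * of_nat (Suc n) * a ^ Suc n / z ^ Suc (Suc n) * (2 * pi * \<i> * q (Suc n))) (circlepath 0 r)" for n
      unfolding q_def g_def[symmetric] by (intro has_contour_integral_lmul coeff g)
    show "summable (\<lambda>n. B * D * (cmod a / r ^ 4) * (real (Suc n) * x ^ n))" by (rule sx)
    show "cmod (f z * of_nat (Suc n) * a ^ Suc n / z ^ Suc (Suc n) * (g u / u ^ Suc (Suc n)))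
        \<le> B * D * (cmod a / r ^ 4) * (real (Suc n) * x ^ n)" if u: "cmod u = r" for n u
    proof -
      have "cmod (f z * of_nat (Suc n) * a ^ Suc n / z ^ Suc (Suc n) * (g u / u ^ Suc (Suc n))) =
          cmod (f z) * cmod (g u) * real (Suc n) * (cmod a ^ Suc n / r ^ Suc (Suc n) / r ^ Suc (Suc n))"
        using z u by (simp add: norm_mult norm_divide norm_power del: power_Suc of_nat_Suc)
      also have "\<dots> \<le> B * D * real (Suc n) * (cmod a ^ Suc n / r ^ Suc (Suc n) / r ^ Suc (Suc n))"
        using B D z u r by (intro mult_right_mono mult_mono) auto
      finally show ?thesis unfolding xn by (simp only: mult_ac)
    qed
    show "(\<lambda>n. f z * of_nat (Suc n) * a ^ Suc n / z ^ Suc (Suc n) * (g u / u ^ Suc (Suc n))) sums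
        (f z * cnj (f (cnj u)) * a / (z * u - a)\<^sup>2)" if u: "cmod u = r" for u
    proof -
      have nz: "z \<noteq> 0" "u \<noteq> 0" using z u r by auto
      have "cmod (a / (z * u)) < 1"
        using a r z u by (simp add: norm_divide norm_mult power2_eq_square)
      from sums_mult[OF geometric_deriv_sums[OF this], of "f z * g u * a / (z * u)\<^sup>2"]
      have "(\<lambda>n. f z * g u * a / (z * u)\<^sup>2 * (of_nat (Suc n) * (a / (z * u)) ^ n)) sums
          (f z * g u * a / (z * u)\<^sup>2 * (1 / (1 - a / (z * u))\<^sup>2))" .
      moreover have "f z * g u * a / (z * u)\<^sup>2 * (1 / (1 - a / (z * u))\<^sup>2) = f z * cnj (f (cnj u)) * a / (z * u - a)\<^sup>2"
      proof -
        have "(z * u)\<^sup>2 * (1 - a / (z * u))\<^sup>2 = (z * u - a)\<^sup>2"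
          using nz by (simp add: field_simps flip: power_mult_distrib)
        then show ?thesis by (simp add: g_def)
      qed
      moreover have "f z * g u * a / (z * u)\<^sup>2 * (of_nat (Suc n) * (a / (z * u)) ^ n) =
          f z * of_nat (Suc n) * a ^ Suc n / z ^ Suc (Suc n) * (g u / u ^ Suc (Suc n))" for n
        by (simp add: power_divide power_mult_distrib power2_eq_square mult_ac del: of_nat_Suc)
      ultimately show ?thesis by simp
    qed
  qed
  \<comment> \<open>Cauchy's estimate for the coefficients of \<open>g\<close> replaces the
    pointwise bound on \<open>g\<close> in the majorant of the outer series.\<close>
  have q: "cmod (2 * pi * \<i> * q (Suc n)) \<le> D / r ^ Suc (Suc n) * (2 * pi * r)" for n
  proof (rule has_contour_integral_bound_circlepath)
    show "((\<lambda>u. g u / u ^ Suc (Suc n)) has_contour_integral 2 * pi * \<i> * q (Suc n)) (circlepath 0 r)"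
      unfolding q_def g_def[symmetric] by (rule coeff[OF g])
  qed (use D r in \<open>auto simp: norm_divide norm_power norm_mult intro!: divide_right_mono\<close>)
  have "(\<lambda>n. of_nat (Suc n) * a ^ Suc n * (2 * pi * \<i> * q (Suc n)) * (2 * pi * \<i> * p (Suc n))) sums
      circle_integral f r a"
    unfolding circle_integral_def
  proof (rule contour_integral_circlepath_sums[OF r(1)])
    show "((\<lambda>z. of_nat (Suc n) * a ^ Suc n * (2 * pi * \<i> * q (Suc n)) * (f z / z ^ Suc (Suc n))) has_contour_integral
       of_nat (Suc n) * a ^ Suc n * (2 * pi * \<i> * q (Suc n)) * (2 * pi * \<i> * p (Suc n))) (circlepath 0 r)" for n
      unfolding p_def by (intro has_contour_integral_lmul coeff f)
    show "summable (\<lambda>n. B * D * (2 * pi * r) * (cmod a / r ^ 4) * (real (Suc n) * x ^ n))" by (rule sx)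
    show "cmod (of_nat (Suc n) * a ^ Suc n * (2 * pi * \<i> * q (Suc n)) * (f z / z ^ Suc (Suc n)))
        \<le> B * D * (2 * pi * r) * (cmod a / r ^ 4) * (real (Suc n) * x ^ n)" if z: "cmod z = r" for n z
    proof -
      have "cmod (of_nat (Suc n) * a ^ Suc n * (2 * pi * \<i> * q (Suc n)) * (f z / z ^ Suc (Suc n))) =
          real (Suc n) * cmod a ^ Suc n * cmod (2 * pi * \<i> * q (Suc n)) * (cmod (f z) / r ^ Suc (Suc n))"
        using z by (simp only: norm_mult norm_divide norm_power norm_of_nat)
      also have "\<dots> \<le> real (Suc n) * cmod a ^ Suc n * (D / r ^ Suc (Suc n) * (2 * pi * r)) * (B / r ^ Suc (Suc n))"
        using q[of n] B z r D by (intro mult_mono divide_right_mono) auto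
      also have "\<dots> = B * D * (2 * pi * r) * real (Suc n) * (cmod a ^ Suc n / r ^ Suc (Suc n) / r ^ Suc (Suc n))"
        by (simp only: times_divide_eq_right times_divide_eq_left mult_ac)
      finally show ?thesis unfolding xn by (simp only: mult_ac)
    qed
    show "(\<lambda>n. of_nat (Suc n) * a ^ Suc n * (2 * pi * \<i> * q (Suc n)) * (f z / z ^ Suc (Suc n))) sums
        contour_integral (circlepath 0 r) (\<lambda>u. f z * cnj (f (cnj u)) * a / (z * u - a)\<^sup>2)" if z: "cmod z = r" for z
      using inner[OF z] by (simp only: times_divide_eq_right times_divide_eq_left mult_ac)
  qed
  moreover have "of_nat (Suc n) * a ^ Suc n * (2 * pi * \<i> * q (Suc n)) * (2 * pi * \<i> * p (Suc n)) =
      - of_real (4 * pi\<^sup>2) * (of_nat (Suc n) * p (Suc n) * q (Suc n) * a ^ Suc n)" for n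
    by (simp add: power2_eq_square)
  ultimately show ?thesis by (simp only:)
qed

text \<open>The coefficients do not depend on the radius, so all admissible circles give the same
  value and the limit from outside at \<open>cmod a = 1\<close> is eventually constant. Splitting
  off the linear term leaves the factor \<open>a\<^sup>2\<close>, which turns square integrability
  of the transform into integrability.\<close>

lemma unit_circle_integral_expansion:
  assumes f: "f holomorphic_on ball 0 R" and R: "1 < R"
  obtains \<gamma> K r where "1 < r" "K holomorphic_on ball 0 r"
    "\<And>a. cmod a \<le> 1 \<Longrightarrow> unit_circle_integral f a = - of_real (4 * pi\<^sup>2) * (\<gamma> * a + a\<^sup>2 * K a)"
proof -
  define c where "c n = of_nat n * ((deriv ^^ n) f 0 / fact n) * ((deriv ^^ n) (cnj \<circ> f \<circ> cnj) 0 / fact n)" for n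
  define K where "K a = (\<Sum>n. c (Suc (Suc n)) * a ^ n)" for a
  \<comment> \<open>Any radius strictly between 1 and \<open>R\<close> would do; the series
    converges for \<open>cmod a < s\<^sup>2\<close>, a disc that contains the closed unit
    disc.\<close>
  define s where "s = (1 + R) / 2"
  have s: "1 < s" "s < R" using R by (auto simp: s_def)
  have circ: "(\<lambda>n. - of_real (4 * pi\<^sup>2) * (c (Suc n) * a ^ Suc n)) sums circle_integral f r a"
    if "0 < r" "r < R" "cmod a < r\<^sup>2" for r a
    using circle_integral_sums[OF f that] unfolding c_def .
  \<comment> \<open>For nonzero \<open>a\<close> the shifted series inherits convergence after
    cancelling \<open>a\<^sup>2\<close>; at 0 only the constant term remains.\<close>
  have K: "(\<lambda>n. c (Suc (Suc n)) * a ^ n) sums K a" if a: "cmod a < s\<^sup>2" for a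
  proof (cases "a = 0")
    case False
    have "summable (\<lambda>n. - of_real (4 * pi\<^sup>2) * (c (Suc n) * a ^ Suc n))"
      using circ[of s a] s a by (auto simp: sums_iff)
    then have "summable (\<lambda>n. c (Suc n) * a ^ Suc n)"
      by (subst (asm) summable_cmult_iff) auto
    then have "summable (\<lambda>n. c (Suc (Suc n)) * a ^ Suc (Suc n))"
      by (subst summable_Suc_iff[of "\<lambda>n. c (Suc n) * a ^ Suc n"])
    then have "summable (\<lambda>n. a\<^sup>2 * (c (Suc (Suc n)) * a ^ n))"
      by (simp add: power2_eq_square mult_ac)
    then have "summable (\<lambda>n. c (Suc (Suc n)) * a ^ n)"
      using False by (subst (asm) summable_cmult_iff) auto
    then show ?thesis by (simp add: K_def summable_sums)
  qed (use powser_sums_zero[of "\<lambda>n. c (Suc (Suc n))"] in \<open>simp add: K_def sums_iff\<close>)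
  have hol: "K holomorphic_on ball 0 (s\<^sup>2)"
    by (rule power_series_holomorphic[where a = "\<lambda>n. c (Suc (Suc n))"]) (use K in simp)
  have s2: "1 < s\<^sup>2" using s by (simp add: one_less_power)
  have val: "circle_integral f r a = - of_real (4 * pi\<^sup>2) * (c 1 * a + a\<^sup>2 * K a)"
    if "0 < r" "r < R" "cmod a < r\<^sup>2" "cmod a \<le> 1" for r a
  proof -
    have "(\<lambda>n. a\<^sup>2 * (c (Suc (Suc n)) * a ^ n)) sums (a\<^sup>2 * K a)"
      using that s2 by (intro sums_mult K) auto
    then have "(\<lambda>n. c (Suc (Suc n)) * a ^ Suc (Suc n)) sums (a\<^sup>2 * K a)"
      by (simp add: power2_eq_square mult_ac)
    then have "(\<lambda>n. c (Suc n) * a ^ Suc n) sums (a\<^sup>2 * K a + c (Suc 0) * a ^ Suc 0)"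
      by (rule sums_Suc[where f = "\<lambda>n. c (Suc n) * a ^ Suc n"])
    from sums_unique2[OF circ[OF that(1-3)] sums_mult[OF this]] show ?thesis
      by (simp add: add.commute)
  qed
  have "unit_circle_integral f a = - of_real (4 * pi\<^sup>2) * (c 1 * a + a\<^sup>2 * K a)" if a: "cmod a \<le> 1" for a
  proof (cases "cmod a < 1")
    case True
    then show ?thesis using val[of 1 a] R by (simp add: unit_circle_integral_def)
  next
    case False
    have "\<forall>\<^sub>F r in at_right 1. circle_integral f r a = - of_real (4 * pi\<^sup>2) * (c 1 * a + a\<^sup>2 * K a)"
    proof -
      have "\<forall>\<^sub>F r in at_right 1. r \<in> {1<..<R}"
        using R by (rule eventually_at_right_real)
      then show ?thesis
      proof eventually_elim
        case (elim r)
        have "1 < r\<^sup>2" using elim by (simp add: one_less_power)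
        with elim a show ?case by (intro val order_le_less_trans[OF a]) auto
      qed
    qed
    then have "((\<lambda>r. circle_integral f r a) \<longlongrightarrow> - of_real (4 * pi\<^sup>2) * (c 1 * a + a\<^sup>2 * K a)) (at_right 1)"
      by (rule tendsto_eventually)
    then show ?thesis using False by (simp add: unit_circle_integral_def tendsto_Lim)
  qed
  with s2 hol show ?thesis by (rule that)
qed

section \<open>Symmetric partial sums and integrals of Fourier transforms\<close>

lemma norm_fourier_le:
  assumes v: "bounded_supported v"
  shows "cmod (fourier v t) \<le> (LINT x|lborel. cmod (v x))"
proof -
  have "cmod (fourier v t) \<le> (LINT x|lborel. cmod (v x * cis (2 * pi * t * x)))"
    unfolding fourier_def by (rule integral_norm_bound)
  then show ?thesis by (simp add: norm_mult)
qed

text \<open>\<open>K\<close> and its derivative are bounded on the closed disc of radius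
  \<open>M\<close>, which lies inside the ball of radius \<open>r\<close>. The function is thus
  dominated by a multiple of the squared transform of \<open>v\<close>. Its derivative contains the
  product of the transforms of \<open>v\<close> and \<open>v'\<close>, which is at most the sum of
  their squared moduli.\<close>

lemma integrable_C1_compose:
  assumes v: "bounded_supported v" and M: "\<And>t. cmod (fourier v t) \<le> M" "M < r"
    and K: "K holomorphic_on ball 0 r"
  defines "v' \<equiv> \<lambda>x. v x * (2 * pi * \<i> * x)"
  shows "integrable_C1 (\<lambda>t. (fourier v t)\<^sup>2 * K (fourier v t))
    (\<lambda>t. fourier v' t * (2 * fourier v t * K (fourier v t) + (fourier v t)\<^sup>2 * deriv K (fourier v t)))"
proof -
  have v': "bounded_supported v'" unfolding v'_def by (rule bounded_supported_moment[OF v])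
  have K': "deriv K holomorphic_on ball 0 r" by (intro holomorphic_deriv K) auto
  have sub: "fourier v t \<in> cball 0 M" for t using M by simp
  have bound: "\<exists>B. \<forall>a\<in>cball 0 M. cmod (h a) \<le> B" if "h holomorphic_on ball 0 r" for h
  proof -
    have "continuous_on (cball 0 M) h"
      using M that by (auto intro!: holomorphic_on_imp_continuous_on[OF holomorphic_on_subset])
    then have "bounded (h ` cball 0 M)"
      by (intro compact_imp_bounded compact_continuous_image) auto
    then show ?thesis by (auto simp: bounded_iff)
  qed
  obtain A where A: "\<And>t. cmod (K (fourier v t)) \<le> A" using bound[OF K] sub by blast
  obtain A' where A': "\<And>t. cmod (deriv K (fourier v t)) \<le> A'" using bound[OF K'] sub by blast
  have A0: "0 \<le> A" "0 \<le> A'" "0 \<le> M"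
    using order_trans[OF norm_ge_zero A[of 0]] order_trans[OF norm_ge_zero A'[of 0]]
      order_trans[OF norm_ge_zero M(1)[of 0]] by auto
  have in_ball: "fourier v t \<in> ball 0 r" for t using M(1)[of t] M(2) by simp
  have cont: "continuous_on UNIV (\<lambda>t. h (fourier v t))" if "h holomorphic_on ball 0 r" for h
    by (rule continuous_on_compose2[OF holomorphic_on_imp_continuous_on[OF that] continuous_on_fourier[OF v]])
       (use in_ball in auto)
  let ?F = "\<lambda>t. (fourier v t)\<^sup>2 * K (fourier v t)"
    and ?F' = "\<lambda>t. fourier v' t * (2 * fourier v t * K (fourier v t) + (fourier v t)\<^sup>2 * deriv K (fourier v t))"
  have cF: "continuous_on UNIV ?F" and cF': "continuous_on UNIV ?F'"
    by (intro continuous_intros continuous_on_fourier v v' cont K K')+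
  show ?thesis
  proof
    fix t
    have "((\<lambda>a. a\<^sup>2 * K a) has_field_derivative (2 * fourier v t * K (fourier v t) + (fourier v t)\<^sup>2 * deriv K (fourier v t))) (at (fourier v t))"
      using holomorphic_derivI[OF K _ in_ball, of t UNIV]
      by (auto intro!: derivative_eq_intros simp: mult_ac)
    from field_vector_diff_chain_at[OF fourier_has_vector_derivative[OF v, folded v'_def] this]
    show "(?F has_vector_derivative ?F' t) (at t)" by (simp add: o_def)
  next
    show "continuous_on UNIV ?F'" by (rule cF')
    have i1: "integrable lborel (\<lambda>t. (cmod (fourier v t))\<^sup>2)" and i2: "integrable lborel (\<lambda>t. (cmod (fourier v' t))\<^sup>2)"
      using fourier_square_integrable v v' by auto
    show "integrable lborel ?F"
    proof (rule Bochner_Integration.integrable_bound)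
      show "integrable lborel (\<lambda>t. A * (cmod (fourier v t))\<^sup>2)" using i1 by simp
      show "?F \<in> borel_measurable lborel" using cF by (simp add: borel_measurable_continuous_onI)
      show "AE t in lborel. cmod (?F t) \<le> norm (A * (cmod (fourier v t))\<^sup>2)"
        using A A0 by (intro AE_I2) (simp add: norm_mult norm_power mult.commute mult_right_mono)
    qed
    show "integrable lborel ?F'"
    proof (rule Bochner_Integration.integrable_bound)
      show "integrable lborel (\<lambda>t. (2 * A + M * A') * ((cmod (fourier v t))\<^sup>2 + (cmod (fourier v' t))\<^sup>2))"
        using i1 i2 by simp
      show "?F' \<in> borel_measurable lborel" using cF' by (simp add: borel_measurable_continuous_onI)
      have "cmod (?F' t) \<le> (2 * A + M * A') * ((cmod (fourier v t))\<^sup>2 + (cmod (fourier v' t))\<^sup>2)" for t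
      proof -
        have "cmod (2 * K (fourier v t) + fourier v t * deriv K (fourier v t)) \<le> 2 * A + M * A'"
        proof (rule order_trans[OF norm_triangle_ineq add_mono])
          show "cmod (2 * K (fourier v t)) \<le> 2 * A" using A[of t] by (simp add: norm_mult)
          show "cmod (fourier v t * deriv K (fourier v t)) \<le> M * A'"
            unfolding norm_mult by (intro mult_mono M A' A0 norm_ge_zero)
        qed
        moreover have "cmod (fourier v' t) * cmod (fourier v t) \<le> (cmod (fourier v t))\<^sup>2 + (cmod (fourier v' t))\<^sup>2"
          using sum_squares_bound[of "cmod (fourier v' t)" "cmod (fourier v t)"]
            mult_nonneg_nonneg[OF norm_ge_zero[of "fourier v' t"] norm_ge_zero[of "fourier v t"]] by linarith
        ultimately have "cmod (fourier v' t) * cmod (fourier v t) * cmod (2 * K (fourier v t) + fourier v t * deriv K (fourier v t))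
            \<le> ((cmod (fourier v t))\<^sup>2 + (cmod (fourier v' t))\<^sup>2) * (2 * A + M * A')"
          by (intro mult_mono) auto
        moreover have eq: "?F' t = fourier v' t * fourier v t * (2 * K (fourier v t) + fourier v t * deriv K (fourier v t))"
          by (simp add: algebra_simps power2_eq_square)
        ultimately show ?thesis unfolding eq norm_mult by (simp only: mult.commute)
      qed
      then show "AE t in lborel. cmod (?F' t) \<le> norm ((2 * A + M * A') * ((cmod (fourier v t))\<^sup>2 + (cmod (fourier v' t))\<^sup>2))"
        unfolding real_norm_def by (intro AE_I2 order_trans[OF _ abs_ge_self])
    qed
  qed
qed

text \<open>With \<open>K = 1\<close>, the square of the transform is integrable with integrable
  derivative and hence vanishes at infinity.\<close>

lemma riemann_lebesgue_at_top:
  assumes "bounded_supported v"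
  shows "(fourier v \<longlongrightarrow> 0) at_top"
proof -
  interpret integrable_C1 "\<lambda>t. (fourier v t)\<^sup>2 * (\<lambda>_. 1) (fourier v t)"
    "\<lambda>t. fourier (\<lambda>x. v x * (2 * pi * \<i> * x)) t * (2 * fourier v t * (\<lambda>_. 1) (fourier v t) + (fourier v t)\<^sup>2 * deriv (\<lambda>_. 1) (fourier v t))"
    by (rule integrable_C1_compose[OF assms norm_fourier_le[OF assms], where r = "(LINT x|lborel. cmod (v x)) + 1"]) auto
  have "((\<lambda>t. (cmod (fourier v t))\<^sup>2) \<longlongrightarrow> 0) at_top"
    using tendsto_norm_zero[OF tendsto_0_at_top] by (simp add: norm_power)
  then have "((\<lambda>t. sqrt ((cmod (fourier v t))\<^sup>2)) \<longlongrightarrow> sqrt 0) at_top"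
    by (rule tendsto_real_sqrt)
  then show ?thesis by (simp add: tendsto_norm_zero_iff)
qed

text \<open>Reflecting \<open>v\<close> turns negative frequencies into positive ones.\<close>

lemma riemann_lebesgue_at_bot:
  assumes v: "bounded_supported v"
  shows "((\<lambda>t. fourier v (- t)) \<longlongrightarrow> 0) at_top"
proof -
  have "bounded_supported (\<lambda>x. v (- x))"
  proof -
    have "(\<lambda>x. v (- x)) \<in> borel_measurable borel"
      using measurable_compose[OF borel_measurable_uminus[OF measurable_ident] bounded_supported_measurable[OF v]] by simp
    moreover have "v (- x) = 0" if "x \<notin> {-1/2..1/2}" for x
    proof -
      have "- x \<notin> {-1/2..1/2}" using that by auto
      then show ?thesis using v unfolding bounded_supported_def by blast
    qed
    ultimately show ?thesis using v unfolding bounded_supported_def by blast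
  qed
  moreover have "fourier v (- t) = fourier (\<lambda>x. v (- x)) t" for t
  proof -
    have reflect: "(LINT x|lborel. h x) = (LINT x|lborel. h (- x))" for h :: "real \<Rightarrow> complex"
      using lborel_integral_real_affine[of "-1" h 0] by simp
    show ?thesis
      unfolding fourier_def by (subst reflect) (simp only: mult_minus_left mult_minus_right minus_minus)
  qed
  ultimately show ?thesis using riemann_lebesgue_at_top[of "\<lambda>x. v (- x)"] by simp
qed

section \<open>Comparison of the discrete and continuous Dirichlet kernels\<close>

lemma bounded_cosecant_remainder:
  "\<exists>C. \<forall>y\<in>{-pi/2..pi/2}. \<bar>1 / sin y - 1 / y\<bar> \<le> C"
proof -
  define k where "k y = 1 / sin y - 1 / y" for y :: real
  have "isCont k y" if y: "y \<in> {-pi/2..pi/2}" for y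
  proof (cases "y = 0")
    case True
    \<comment> \<open>The singularity at 0 is removable, and the value there already fits: division
      by zero gives \<open>k 0 = 0\<close>, which is the limit.\<close>
    have "(k \<longlongrightarrow> 0) (at 0)" unfolding k_def by real_asymp
    then show ?thesis using True by (simp add: isCont_def k_def)
  next
    case False
    then have "sin y \<noteq> 0" using y sin_gt_zero[of y] sin_gt_zero[of "- y"] pi_gt_zero
      by (cases "y > 0") (auto simp: field_simps)
    then show ?thesis using False unfolding k_def by (intro continuous_intros) auto
  qed
  then have "bounded (k ` {-pi/2..pi/2})"
    by (intro compact_imp_bounded compact_continuous_image) (auto intro: continuous_at_imp_continuous_on)
  then show ?thesis by (auto simp: bounded_iff k_def)
qed

text \<open>Each step adds \<open>2 cos ((N + 1) \<theta>) sin (\<theta> / 2)\<close>, the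
  difference of two consecutive right-hand sides, so the sum telescopes. The multiplied form also
  covers the zeros of \<open>sin (\<theta> / 2)\<close>.\<close>

lemma dirichlet_kernel:
  "(\<Sum>k\<in>{- int N..int N}. cis (of_int k * \<theta>)) * of_real (sin (\<theta> / 2)) = of_real (sin ((real N + 1/2) * \<theta>))"
proof (induction N)
  case (Suc N)
  have "{- int (Suc N)..int (Suc N)} = insert (- int (Suc N)) (insert (int (Suc N)) {- int N..int N})"
    by auto
  then have "(\<Sum>k\<in>{- int (Suc N)..int (Suc N)}. cis (of_int k * \<theta>)) =
      cis (- (real (Suc N) * \<theta>)) + cis (real (Suc N) * \<theta>) + (\<Sum>k\<in>{- int N..int N}. cis (of_int k * \<theta>))"
    by (simp add: algebra_simps)
  moreover have "cis (- (real (Suc N) * \<theta>)) + cis (real (Suc N) * \<theta>) = of_real (2 * cos (real (Suc N) * \<theta>))"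
    by (simp add: complex_eq_iff)
  ultimately have "(\<Sum>k\<in>{- int (Suc N)..int (Suc N)}. cis (of_int k * \<theta>)) * of_real (sin (\<theta> / 2)) =
      of_real (2 * cos (real (Suc N) * \<theta>) * sin (\<theta> / 2) + sin ((real N + 1/2) * \<theta>))"
    using Suc by (simp only: distrib_right of_real_add of_real_mult)
  moreover have "2 * cos (real (Suc N) * \<theta>) * sin (\<theta> / 2) = sin ((real (Suc N) + 1/2) * \<theta>) - sin ((real N + 1/2) * \<theta>)"
  proof -
    have eqs: "((real (Suc N) + 1/2) * \<theta> - (real N + 1/2) * \<theta>) / 2 = \<theta> / 2"
        "((real (Suc N) + 1/2) * \<theta> + (real N + 1/2) * \<theta>) / 2 = real (Suc N) * \<theta>"
      by (simp_all add: field_simps)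
    show ?thesis
      unfolding sin_diff_sin eqs by (rule mult.commute[THEN trans]) (simp only: mult_ac)
  qed
  ultimately show ?case by (simp only: diff_add_cancel)
qed simp

lemma integral_cis_symmetric:
  assumes "x \<noteq> 0" "0 \<le> T"
  shows "integral {-T..T} (\<lambda>t. cis (2 * pi * t * x)) = of_real (sin (2 * pi * T * x) / (pi * x))"
proof -
  define F where "F = (\<lambda>t::real. cis (2 * pi * x * t) / (of_real (2 * pi * x) * \<i>))"
  have "((\<lambda>t. cis (2 * pi * x * t)) has_integral (F T - F (- T))) {-T..T}"
  proof (rule fundamental_theorem_of_calculus)
    fix t :: real
    show "(F has_vector_derivative cis (2 * pi * x * t)) (at t within {-T..T})"
      using has_vector_derivative_divide[OF has_vector_derivative_cis_linear[of "2 * pi * x" t],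
          where a = "of_real (2 * pi * x) * \<i>"] assms(1)
      unfolding F_def by simp
  qed (use assms in simp)
  moreover have "F T - F (- T) = of_real (sin (2 * pi * T * x) / (pi * x))"
  proof -
    have "F T - F (- T) = (cis (2 * pi * x * T) - cis (- (2 * pi * x * T))) / (of_real (2 * pi * x) * \<i>)"
      by (simp add: F_def diff_divide_distrib)
    moreover have "cis (2 * pi * x * T) - cis (- (2 * pi * x * T)) = of_real (2 * sin (2 * pi * x * T)) * \<i>"
      by (simp add: complex_eq_iff)
    ultimately show ?thesis using assms(1) by (simp add: mult_ac)
  qed
  ultimately show ?thesis by (simp add: integral_unique mult_ac)
qed

text \<open>The integrand is bounded and supported on a rectangle, so Fubini's theorem applies; the
  inner integral over \<open>t\<close> is the continuous Dirichlet kernel.\<close>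

lemma symmetric_integral_fourier:
  assumes v: "bounded_supported v" and T: "0 \<le> T"
  shows "integral {-T..T} (fourier v) = (LINT x|lborel. v x * of_real (sin (2 * pi * T * x) / (pi * x)))"
proof -
  define f where "f x t = indicator {-T..T} t *\<^sub>R (v x * cis (2 * pi * t * x))" for x t :: real
  obtain C where C: "\<And>x. cmod (v x) \<le> C"
    using v by (auto simp: bounded_supported_def)
  have vm [measurable]: "v \<in> borel_measurable borel"
    by (rule bounded_supported_measurable[OF v])
  have int: "integrable (lborel \<Otimes>\<^sub>M lborel) (case_prod f)"
  proof (rule integrableI_bounded_set[where A = "{-1/2..1/2} \<times> {-T..T}" and B = C])
    show "emeasure (lborel \<Otimes>\<^sub>M lborel) ({- 1 / 2..1 / 2::real} \<times> {- T..T}) < \<infinity>"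
      by (subst lborel.emeasure_pair_measure_Times) (auto simp: ennreal_mult_less_top emeasure_lborel_Icc_eq)
    show "AE z in lborel \<Otimes>\<^sub>M lborel. z \<in> {- 1 / 2..1 / 2} \<times> {- T..T} \<longrightarrow> norm (case_prod f z) \<le> C"
      using C by (auto simp: f_def norm_mult)
    show "AE z in lborel \<Otimes>\<^sub>M lborel. z \<notin> {- 1 / 2..1 / 2} \<times> {- T..T} \<longrightarrow> case_prod f z = 0"
      using v by (intro AE_I2) (auto simp: f_def indicator_def bounded_supported_def)
    show "case_prod f \<in> borel_measurable (lborel \<Otimes>\<^sub>M lborel)"
      unfolding f_def by measurable
  qed (intro pair_measureI, auto)
  have set_int: "(LINT t|lborel. indicator {-T..T} t *\<^sub>R h t) = integral {-T..T} h"
    if "continuous_on UNIV h" for h :: "real \<Rightarrow> complex"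
    unfolding set_lebesgue_integral_def[symmetric]
    by (intro set_borel_integral_eq_integral borel_integrable_atLeastAtMost' continuous_on_subset[OF that]) auto
  have 1: "integral {-T..T} (fourier v) = (LINT t|lborel. LINT x|lborel. f x t)"
    unfolding set_int[OF continuous_on_fourier[OF v], symmetric] f_def fourier_def by simp
  \<comment> \<open>At \<open>x = 0\<close> the kernel is \<open>2 T\<close>, while the quotient on
    the right is 0 by division by zero; this point is discarded below as a null set.\<close>
  have 2: "(LINT t|lborel. f x t) = v x * of_real (sin (2 * pi * T * x) / (pi * x))" if "x \<noteq> 0" for x
  proof -
    have "continuous_on UNIV (\<lambda>t. cis (2 * pi * t * x))" by (intro continuous_intros)
    note set_int[OF this]
    moreover have "(LINT t|lborel. f x t) = v x * (LINT t|lborel. indicator {-T..T} t *\<^sub>R cis (2 * pi * t * x))"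
      unfolding f_def mult_scaleR_right[symmetric] by (rule integral_mult_right_zero)
    ultimately show ?thesis by (simp only: integral_cis_symmetric[OF that T])
  qed
  show ?thesis
    unfolding 1 lborel_pair.Fubini_integral[OF int]
  proof (rule integral_cong_AE)
    show "(\<lambda>x. LINT t|lborel. f x t) \<in> borel_measurable lborel"
      by (rule borel_measurable_integrable[OF lborel_pair.integrable_fst[OF int]])
    show "AE x in lborel. (LINT t|lborel. f x t) = v x * of_real (sin (2 * pi * T * x) / (pi * x))"
      using AE_lborel_singleton[of 0] by eventually_elim (rule 2)
  qed simp
qed

text \<open>With \<open>T = (N + 1/2) * \<nu>\<close> the two kernels are
  \<open>\<nu> sin (2 pi T x) / sin (pi \<nu> x)\<close> and \<open>sin (2 pi T x) / (pi x)\<close>.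
  They share a numerator, and the remaining factors differ by a function bounded on the support. The
  error is therefore a combination of values at \<open>T\<close> and \<open>-T\<close> of the
  transform of one fixed function.\<close>

lemma symmetric_sum_minus_integral_tendsto_0:
  assumes v: "bounded_supported v" and \<nu>: "0 < \<nu>" "\<nu> \<le> 1"
  shows "(\<lambda>N. of_real \<nu> * (\<Sum>k\<in>{- int N..int N}. fourier v (of_int k * \<nu>)) -
    integral {- ((real N + 1/2) * \<nu>)..(real N + 1/2) * \<nu>} (fourier v)) \<longlonglongrightarrow> 0"
proof -
  define h where "h x = \<nu> / sin (pi * \<nu> * x) - 1 / (pi * x)" for x :: real
  define u where "u x = v x * of_real (h x)" for x
  obtain C where C: "\<And>y. y \<in> {-pi/2..pi/2} \<Longrightarrow> \<bar>1 / sin y - 1 / y\<bar> \<le> C"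
    using bounded_cosecant_remainder by blast
  \<comment> \<open>The bound \<open>\<nu> \<le> 1\<close> keeps the argument in
    \<open>[-pi/2, pi/2]\<close>, where 0 is the only zero of the sine.\<close>
  have range: "pi * \<nu> * x \<in> {-pi/2..pi/2}" if "x \<in> {-1/2..1/2}" for x
  proof -
    have "\<bar>\<nu> * x\<bar> \<le> 1 * (1/2)"
      unfolding abs_mult using \<nu> that by (intro mult_mono) auto
    then have "pi * \<bar>\<nu> * x\<bar> \<le> pi * (1/2)" by (intro mult_left_mono) auto
    then have "\<bar>pi * \<nu> * x\<bar> \<le> pi / 2" by (simp add: abs_mult mult.assoc)
    then show ?thesis unfolding atLeastAtMost_iff by linarith
  qed
  have vm [measurable]: "v \<in> borel_measurable borel"
    by (rule bounded_supported_measurable[OF v])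
  have u: "bounded_supported u"
    unfolding u_def
  proof (rule bounded_supported_mult[OF v, where C = "\<nu> * C"])
    show "(\<lambda>x. complex_of_real (h x)) \<in> borel_measurable borel"
      unfolding h_def by measurable
    show "cmod (of_real (h x)) \<le> \<nu> * C" if "x \<in> {-1/2..1/2}" for x
    proof -
      have "h x = \<nu> * (1 / sin (pi * \<nu> * x) - 1 / (pi * \<nu> * x))"
        using \<nu> by (simp add: h_def right_diff_distrib)
      then show ?thesis
        using C[OF range[OF that]] \<nu> by (simp add: abs_mult del: of_real_diff of_real_mult of_real_divide)
    qed
  qed
  have eq: "of_real \<nu> * (\<Sum>k\<in>{- int N..int N}. fourier v (of_int k * \<nu>)) -
      integral {- ((real N + 1/2) * \<nu>)..(real N + 1/2) * \<nu>} (fourier v) =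
      (fourier u ((real N + 1/2) * \<nu>) - fourier u (- ((real N + 1/2) * \<nu>))) / (2 * \<i>)" for N
  proof -
    define T where "T = (real N + 1/2) * \<nu>"
    define g1 where "g1 x = of_real \<nu> * (\<Sum>k\<in>{- int N..int N}. v x * cis (2 * pi * (of_int k * \<nu>) * x))" for x
    \<comment> \<open>On the support this is \<open>u x * sin (2 pi T x)\<close>; the exponential
      form lets its integral be read off from \<open>fourier u\<close>.\<close>
    define g3 where "g3 x = (u x * cis (2 * pi * T * x) - u x * cis (2 * pi * (- T) * x)) / (2 * \<i>)" for x
    have T0: "0 \<le> T" using \<nu> by (simp add: T_def)
    have i1: "integrable lborel g1" and I1: "(LINT x|lborel. g1 x) = of_real \<nu> * (\<Sum>k\<in>{- int N..int N}. fourier v (of_int k * \<nu>))"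
      unfolding g1_def fourier_def by (simp_all add: bounded_supported_integrable_cis[OF v])
    have i3: "integrable lborel g3" and I3: "(LINT x|lborel. g3 x) = (fourier u T - fourier u (- T)) / (2 * \<i>)"
      unfolding g3_def fourier_def
      by (simp_all only: integral_divide_zero Bochner_Integration.integral_diff integrable_divide_zero Bochner_Integration.integrable_diff
          bounded_supported_integrable_cis[OF u])
    have pt: "v x * of_real (sin (2 * pi * T * x) / (pi * x)) = g1 x - g3 x" if "x \<noteq> 0" for x
    proof (cases "x \<in> {-1/2..1/2}")
      case True
      define y where "y = pi * \<nu> * x"
      have "y \<noteq> 0" using that \<nu> by (simp add: y_def)
      then have siny: "sin y \<noteq> 0"
        using range[OF True, folded y_def] sin_gt_zero[of y] sin_gt_zero[of "- y"] pi_gt_zero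
        by (cases "y > 0") auto
      have "(\<Sum>k\<in>{- int N..int N}. cis (of_int k * (2 * y))) * of_real (sin y) = of_real (sin ((real N + 1/2) * (2 * y)))"
        using dirichlet_kernel[where N = N and \<theta> = "2 * y"] by simp
      moreover have "(real N + 1/2) * (2 * y) = 2 * pi * T * x"
        by (simp add: y_def T_def)
      ultimately have "(\<Sum>k\<in>{- int N..int N}. cis (of_int k * (2 * y))) = of_real (sin (2 * pi * T * x) / sin y)"
        using siny by (simp add: field_simps)
      moreover have "g1 x = v x * of_real \<nu> * (\<Sum>k\<in>{- int N..int N}. cis (of_int k * (2 * y)))"
        by (simp add: g1_def y_def sum_distrib_left mult_ac)
      ultimately have G1: "g1 x = v x * of_real \<nu> * of_real (sin (2 * pi * T * x) / sin y)"
        by simp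
      have "cis (2 * pi * T * x) - cis (2 * pi * (- T) * x) = 2 * \<i> * of_real (sin (2 * pi * T * x))"
        by (simp add: complex_eq_iff)
      then have "g3 x = (2 * \<i>) * (u x * of_real (sin (2 * pi * T * x))) / (2 * \<i>)"
        unfolding g3_def right_diff_distrib[symmetric] by (simp only: mult_ac)
      then have G3: "g3 x = u x * of_real (sin (2 * pi * T * x))"
        by simp
      show ?thesis
        unfolding G1 G3 u_def h_def y_def by (simp add: algebra_simps)
    next
      case False
      then show ?thesis using v by (auto simp: bounded_supported_def g1_def g3_def u_def)
    qed
    have "integral {-T..T} (fourier v) = (LINT x|lborel. g1 x - g3 x)"
      unfolding symmetric_integral_fourier[OF v T0]
    proof (rule integral_cong_AE)
      show "AE x in lborel. v x * of_real (sin (2 * pi * T * x) / (pi * x)) = g1 x - g3 x"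
        using AE_lborel_singleton[of 0] by eventually_elim (rule pt)
    qed (use i1 i3 in auto)
    also have "\<dots> = (LINT x|lborel. g1 x) - (LINT x|lborel. g3 x)"
      by (rule Bochner_Integration.integral_diff[OF i1 i3])
    finally show ?thesis unfolding I1 I3 T_def by simp
  qed
  have lim: "filterlim (\<lambda>N. (real N + 1/2) * \<nu>) at_top sequentially"
    using \<nu> by real_asymp
  have "(\<lambda>N. (fourier u ((real N + 1/2) * \<nu>) - fourier u (- ((real N + 1/2) * \<nu>))) / (2 * \<i>)) \<longlonglongrightarrow> (0 - 0) / (2 * \<i>)"
    by (intro tendsto_intros filterlim_compose[OF riemann_lebesgue_at_top[OF u] lim]
        filterlim_compose[OF riemann_lebesgue_at_bot[OF u] lim]) simp
  then show ?thesis unfolding eq by simp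
qed

text \<open>Both tails of the transform are eventually below \<open>e / 2\<close>, and two symmetric
  integrals differ by one interval on each side. This carries convergence from the points
  \<open>(N + 1/2) * \<nu>\<close> to all real \<open>T\<close>.\<close>

lemma symmetric_integral_slowly_varying:
  assumes v: "bounded_supported v" and e: "0 < e"
  shows "\<exists>T0\<ge>0. \<forall>a b. T0 \<le> a \<longrightarrow> T0 \<le> b \<longrightarrow>
    cmod (integral {-a..a} (fourier v) - integral {-b..b} (fourier v)) \<le> e * \<bar>a - b\<bar>"
proof -
  have "\<forall>\<^sub>F t in at_top. cmod (fourier v t) < e / 2 \<and> cmod (fourier v (- t)) < e / 2"
    using riemann_lebesgue_at_top[OF v] riemann_lebesgue_at_bot[OF v] e
    by (intro eventually_conj order_tendstoD(2)[of _ 0] tendsto_norm_zero) auto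
  then obtain T1 where T1: "\<And>t. T1 \<le> t \<Longrightarrow> cmod (fourier v t) < e / 2 \<and> cmod (fourier v (- t)) < e / 2"
    by (auto simp: eventually_at_top_linorder)
  have gi: "fourier v integrable_on {a..b}" for a b
    by (intro integrable_continuous_interval continuous_on_fourier v)
  have le: "cmod (integral {-b..b} (fourier v) - integral {-a..a} (fourier v)) \<le> e * (b - a)"
    if "max 0 T1 \<le> a" "a \<le> b" for a b
  proof -
    have "integral {-b..b} (fourier v) = integral {-b..-a} (fourier v) + integral {-a..a} (fourier v) + integral {a..b} (fourier v)"
      using Henstock_Kurzweil_Integration.integral_combine[OF _ _ gi, of "- b" "- a" a]
        Henstock_Kurzweil_Integration.integral_combine[OF _ _ gi, of "- b" a b] that by simp
    moreover have "cmod (integral {a..b} (fourier v)) \<le> e / 2 * (b - a)"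
      using that T1 by (intro integral_bound continuous_on_fourier v) (auto intro: less_imp_le)
    moreover have "cmod (integral {-b..-a} (fourier v)) \<le> e / 2 * (- a - - b)"
    proof (rule integral_bound)
      fix t assume "t \<in> {-b..-a}"
      then show "cmod (fourier v t) \<le> e / 2" using T1[of "- t"] that by auto
    qed (use that v in \<open>auto intro: continuous_on_fourier\<close>)
    ultimately show ?thesis
      using norm_triangle_ineq[of "integral {-b..-a} (fourier v)" "integral {a..b} (fourier v)"]
      by (simp add: algebra_simps)
  qed
  show ?thesis
  proof (intro exI[of _ "max 0 T1"] conjI allI impI)
    fix a b :: real assume ab: "max 0 T1 \<le> a" "max 0 T1 \<le> b"
    show "cmod (integral {-a..a} (fourier v) - integral {-b..b} (fourier v)) \<le> e * \<bar>a - b\<bar>"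
      using le[of a b] le[of b a] ab by (cases "a \<le> b") (auto simp: norm_minus_commute)
  qed simp
qed

text \<open>The sums follow the integrals at the points \<open>t N\<close> by the kernel comparison.
  These points have spacing \<open>\<nu>\<close>, and slow variation controls the integral between
  them. As the right-hand side does not involve \<open>\<nu>\<close>, the limit is the same for
  every mesh.\<close>

lemma symmetric_sum_tendsto_iff:
  assumes v: "bounded_supported v" and \<nu>: "0 < \<nu>" "\<nu> \<le> 1"
  shows "((\<lambda>N. of_real \<nu> * (\<Sum>k\<in>{- int N..int N}. fourier v (of_int k * \<nu>))) \<longlonglongrightarrow> L) \<longleftrightarrow>
    ((\<lambda>T. integral {-T..T} (fourier v)) \<longlongrightarrow> L) at_top"
proof -
  define J where "J T = integral {-T..T} (fourier v)" for T
  define S where "S N = of_real \<nu> * (\<Sum>k\<in>{- int N..int N}. fourier v (of_int k * \<nu>))" for N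
  define t where "t N = (real N + 1/2) * \<nu>" for N
  have diff: "(\<lambda>N. S N - J (t N)) \<longlonglongrightarrow> 0"
    using symmetric_sum_minus_integral_tendsto_0[OF v \<nu>] by (simp add: S_def J_def t_def)
  have t_lim: "filterlim t at_top sequentially"
    unfolding t_def using \<nu> by real_asymp
  have "S \<longlonglongrightarrow> L" if "(J \<longlongrightarrow> L) at_top"
    using tendsto_add[OF diff filterlim_compose[OF that t_lim]] by simp
  moreover have "(J \<longlongrightarrow> L) at_top" if "S \<longlonglongrightarrow> L"
  proof -
    define n where "n T = nat \<lfloor>T / \<nu>\<rfloor>" for T
    have n_lim: "filterlim n sequentially at_top"
      unfolding n_def using \<nu> by (intro filterlim_compose[OF filterlim_nat_sequentially] filterlim_compose[OF filterlim_floor_sequentially]) real_asymp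
    have "(\<lambda>N. J (t N)) \<longlonglongrightarrow> L"
      using tendsto_diff[OF that diff] by simp
    then have lim: "((\<lambda>T. J (t (n T))) \<longlongrightarrow> L) at_top"
      by (rule filterlim_compose) (rule n_lim)
    have near: "\<bar>T - t (n T)\<bar> \<le> \<nu>" if "0 \<le> T" for T
    proof -
      have "real (n T) = of_int \<lfloor>T / \<nu>\<rfloor>" using that \<nu> by (simp add: n_def)
      then have "real (n T) \<le> T / \<nu>" "T / \<nu> < real (n T) + 1" by linarith+
      then have "real (n T) * \<nu> \<le> T" "T < real (n T) * \<nu> + \<nu>"
        using \<nu> by (auto simp: field_simps)
      then show ?thesis using \<nu> by (simp add: t_def algebra_simps abs_le_iff)
    qed
    have "((\<lambda>T. J T - J (t (n T))) \<longlongrightarrow> 0) at_top"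
    proof (rule tendstoI)
      fix e :: real assume "e > 0"
      then obtain T0 where T0: "0 \<le> T0" "\<And>a b. T0 \<le> a \<Longrightarrow> T0 \<le> b \<Longrightarrow> cmod (J a - J b) \<le> e / 2 * \<bar>a - b\<bar>"
        using symmetric_integral_slowly_varying[OF v, of "e / 2"] unfolding J_def by auto
      show "\<forall>\<^sub>F T in at_top. dist (J T - J (t (n T))) 0 < e"
        using eventually_ge_at_top[of "T0 + 1"]
      proof eventually_elim
        case (elim T)
        \<comment> \<open>The extra 1 in \<open>T0 + 1\<close> leaves room for
          \<open>t (n T)\<close>, which is within \<open>\<nu> \<le> 1\<close> of \<open>T\<close>,
          to stay above \<open>T0\<close>.\<close>
        have nr: "\<bar>T - t (n T)\<bar> \<le> \<nu>" using elim T0(1) by (intro near) auto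
        then have "cmod (J T - J (t (n T))) \<le> e / 2 * \<bar>T - t (n T)\<bar>"
          using elim \<nu> by (intro T0(2)) auto
        also have "\<dots> \<le> e / 2 * 1" using nr \<nu> \<open>e > 0\<close> by (intro mult_left_mono) auto
        finally show ?case using \<open>e > 0\<close> by simp
      qed
    qed
    from tendsto_add[OF this lim] show ?thesis by simp
  qed
  ultimately show ?thesis unfolding S_def J_def by blast
qed

section \<open>The limiting variances\<close>

text \<open>The one-sided limits bound \<open>w\<close> near each point, and bounds on adjacent
  intervals combine, as the bisection principle requires.\<close>

lemma one_sided_limits_bounded:
  fixes w :: "real \<Rightarrow> real"
  assumes "\<And>x. \<exists>l. (w \<longlongrightarrow> l) (at_left x)" "\<And>x. \<exists>l. (w \<longlongrightarrow> l) (at_right x)" and "a \<le> b"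
  shows "\<exists>C. \<forall>x\<in>{a..b}. \<bar>w x\<bar> \<le> C"
  using \<open>a \<le> b\<close>
proof (induction a b rule: Bolzano)
  case (trans a b c)
  then obtain C D where "\<forall>x\<in>{a..b}. \<bar>w x\<bar> \<le> C" "\<forall>x\<in>{b..c}. \<bar>w x\<bar> \<le> D" by blast
  then have "\<forall>x\<in>{a..c}. \<bar>w x\<bar> \<le> max C D"
    by (metis atLeastAtMost_iff le_max_iff_disj linorder_le_cases)
  then show ?case by blast
next
  case (local x)
  obtain l where "(w \<longlongrightarrow> l) (at_left x)" using assms(1) by blast
  then have "\<forall>\<^sub>F y in at_left x. \<bar>w y\<bar> < \<bar>l\<bar> + 1"
    by (intro order_tendstoD(2)[of "\<lambda>y. \<bar>w y\<bar>" "\<bar>l\<bar>"] tendsto_rabs) auto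
  then obtain c where c: "c < x" "\<And>y. c < y \<Longrightarrow> y < x \<Longrightarrow> \<bar>w y\<bar> < \<bar>l\<bar> + 1"
    by (auto simp: eventually_at_left[of "x - 1"])
  obtain m where "(w \<longlongrightarrow> m) (at_right x)" using assms(2) by blast
  then have "\<forall>\<^sub>F y in at_right x. \<bar>w y\<bar> < \<bar>m\<bar> + 1"
    by (intro order_tendstoD(2)[of "\<lambda>y. \<bar>w y\<bar>" "\<bar>m\<bar>"] tendsto_rabs) auto
  then obtain d where d: "x < d" "\<And>y. x < y \<Longrightarrow> y < d \<Longrightarrow> \<bar>w y\<bar> < \<bar>m\<bar> + 1"
    by (auto simp: eventually_at_right[of x "x + 1"])
  \<comment> \<open>The value \<open>w x\<close> enters separately because the one-sided limits do
    not control it.\<close>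
  have near: "\<bar>w y\<bar> \<le> max \<bar>w x\<bar> (max (\<bar>l\<bar> + 1) (\<bar>m\<bar> + 1))" if "c < y" "y < d" for y
    using c(2)[of y] d(2)[of y] that by (cases y x rule: linorder_cases) (auto simp: le_max_iff_disj less_imp_le)
  show ?case
  proof (rule exI[of _ "min (x - c) (d - x)"], intro conjI allI impI)
    fix a b assume "a \<le> x \<and> x \<le> b \<and> b - a < min (x - c) (d - x)"
    then show "\<exists>C. \<forall>y\<in>{a..b}. \<bar>w y\<bar> \<le> C"
      by (intro exI[of _ "max \<bar>w x\<bar> (max (\<bar>l\<bar> + 1) (\<bar>m\<bar> + 1))"] ballI near) auto
  qed (use c(1) d(1) in auto)
qed

text \<open>Having finitely many discontinuities gives measurability, and the one-sided limits give
  boundedness.\<close>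

lemma variance_profile_bounded_supported:
  assumes "variance_profile w"
  shows "bounded_supported (\<lambda>x. of_real (w x))"
proof -
  have supp: "w x = 0" if "x \<notin> {-1/2..1/2}" for x
    using assms that unfolding variance_profile_def by blast
  have pw: "piecewise_continuous w" using assms by (simp add: variance_profile_def)
  have "continuous_on (- {x. \<not> isCont w x}) w"
    by (rule continuous_at_imp_continuous_on) auto
  moreover have "countable {x. \<not> isCont w x}"
    using pw by (simp add: piecewise_continuous_def countable_finite)
  ultimately have [measurable]: "w \<in> borel_measurable borel"
    by (intro borel_measurable_continuous_countable_exceptions)
  obtain C where C: "\<forall>x\<in>{-1/2..1/2}. \<bar>w x\<bar> \<le> C"
    using one_sided_limits_bounded[of w "-1/2" "1/2"] pw by (auto simp: piecewise_continuous_def)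
  have "\<bar>w x\<bar> \<le> max 0 C" for x
    using C supp[of x] by (cases "x \<in> {-1/2..1/2}") (auto intro: max.coboundedI2)
  then show ?thesis
    using supp unfolding bounded_supported_def by (auto intro!: exI[of _ "max 0 C"])
qed

section \<open>The transform of a variance profile\<close>

lemma integral_bounded_supported:
  assumes v: "bounded_supported v"
  shows "integral {-1/2..1/2} v = (LINT x|lborel. v x)"
proof -
  have "(v has_integral (LINT x|lborel. v x)) UNIV"
    by (rule has_integral_integral_lborel[OF bounded_supported_integrable[OF v]])
  moreover have "v = (\<lambda>x. if x \<in> {-1/2..1/2} then v x else 0)"
    using v unfolding bounded_supported_def fun_eq_iff by presburger
  ultimately have "(v has_integral (LINT x|lborel. v x)) {-1/2..1/2}"
    using has_integral_restrict_UNIV by metis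
  then show ?thesis by (rule integral_unique)
qed

lemma w_hat0_eq_fourier:
  assumes "variance_profile w"
  shows "w_hat0 w = fourier (\<lambda>x. of_real (w x))"
  using integral_bounded_supported[OF bounded_supported_cis[OF variance_profile_bounded_supported[OF assms]]]
  by (simp add: w_hat0_def fourier_def fun_eq_iff)

text \<open>The coefficients sample one transform at mesh \<open>\<nu>\<close>, which makes the
  variance for \<open>\<nu> > 0\<close> a limit of Riemann sums.\<close>

lemma w_hat_eq_w_hat0: "w_hat w \<nu> k = w_hat0 w (of_int k * \<nu>)"
  unfolding w_hat_def w_hat0_def
  by (intro Henstock_Kurzweil_Integration.integral_cong) (simp add: mult_ac)

text \<open>A nonnegative \<open>w\<close> of total mass 1 has a transform bounded by 1; this keeps
  every argument in the disc where the expansion holds.\<close>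

lemma norm_w_hat0_le_1:
  assumes "variance_profile w"
  shows "cmod (w_hat0 w t) \<le> 1"
proof -
  have nonneg: "\<And>x. 0 \<le> w x" and int: "(w has_integral 1) {-1/2..1/2}"
    using assms by (auto simp: variance_profile_def)
  note v = variance_profile_bounded_supported[OF assms]
  have "complex_of_real (LINT x|lborel. w x) = integral {-1/2..1/2} (\<lambda>x. complex_of_real (w x))"
    using integral_bounded_supported[OF v] integral_complex_of_real[of lborel w] by simp
  also have "\<dots> = of_real 1"
    by (intro integral_unique has_integral_of_real int)
  finally have "(LINT x|lborel. w x) = 1" by (simp only: of_real_eq_iff)
  then show ?thesis
    using norm_fourier_le[OF v, of t] nonneg by (simp add: w_hat0_eq_fourier[OF assms])
qed

text \<open>If neither limit exists, both \<open>Lim\<close> terms are descriptions of the empty predicate and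
  therefore still equal.\<close>

lemma Lim_eq_if_divergent:
  assumes "\<nexists>l. (f \<longlongrightarrow> l) F" "\<nexists>l. (g \<longlongrightarrow> l) G"
  shows "Lim F f = Lim G g"
proof -
  have "(\<lambda>l. (f \<longlongrightarrow> l) F) = (\<lambda>l. (g \<longlongrightarrow> l) G)" using assms by auto
  then show ?thesis unfolding Topological_Spaces.Lim_def by simp
qed

lemma tendsto_affine_iff:
  fixes S R :: "'a \<Rightarrow> complex"
  assumes "(R \<longlongrightarrow> s) F" "\<gamma> \<noteq> 0"
  shows "((\<lambda>x. \<gamma> * S x + R x) \<longlongrightarrow> l) F \<longleftrightarrow> (S \<longlongrightarrow> (l - s) / \<gamma>) F"
proof
  assume "((\<lambda>x. \<gamma> * S x + R x) \<longlongrightarrow> l) F"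
  from tendsto_divide[OF tendsto_diff[OF this assms(1)] tendsto_const assms(2)] assms(2)
  show "(S \<longlongrightarrow> (l - s) / \<gamma>) F" by simp
next
  assume "(S \<longlongrightarrow> (l - s) / \<gamma>) F"
  from tendsto_add[OF tendsto_mult[OF tendsto_const[of \<gamma>] this] assms(1)] assms(2)
  show "((\<lambda>x. \<gamma> * S x + R x) \<longlongrightarrow> l) F" by simp
qed

text \<open>Each variance splits into a linear part, governed by \<open>J\<close>, and a remainder
  built from \<open>H\<close>. The linear parts all have one common limit or all diverge, and the
  remainders are within \<open>\<nu> * A\<close> of \<open>I\<close>.\<close>

lemma limit_variance_tendsto:
  assumes w: "variance_profile w" and f: "f holomorphic_on ball 0 R" and R: "1 < R"
  shows "((\<lambda>\<nu>. limit_variance w f \<nu>) \<longlongrightarrow> limit_variance w f 0) (at_right 0)"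
proof -
  obtain \<gamma> K r where r: "1 < r" and K: "K holomorphic_on ball 0 r"
    and G: "\<And>a. cmod a \<le> 1 \<Longrightarrow> unit_circle_integral f a = - of_real (4 * pi\<^sup>2) * (\<gamma> * a + a\<^sup>2 * K a)"
    by (rule unit_circle_integral_expansion[OF f R]) (rule that)
  define v where "v = (\<lambda>x. complex_of_real (w x))"
  have v: "bounded_supported v"
    unfolding v_def by (rule variance_profile_bounded_supported[OF w])
  have le1: "cmod (fourier v t) \<le> 1" for t
    using norm_w_hat0_le_1[OF w] by (simp add: w_hat0_eq_fourier[OF w] v_def)
  define H where "H = (\<lambda>t. (fourier v t)\<^sup>2 * K (fourier v t))"
  obtain H' where "integrable_C1 H H'"
    by (rule that[OF integrable_C1_compose[OF v le1 r K, folded H_def]])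
  then interpret H: integrable_C1 H H' .
  define I where "I = (LINT t|lborel. H t)"
  define A where "A = (LINT t|lborel. norm (H' t))"
  define J where "J T = integral {-T..T} (fourier v)" for T
  define S where "S \<nu> N = of_real \<nu> * (\<Sum>k\<in>{- int N..int N}. fourier v (of_int k * \<nu>))" for \<nu> N
  define Q where "Q \<nu> N = of_real \<nu> * (\<Sum>k\<in>{- int N..int N}. H (of_int k * \<nu>))" for \<nu> N
  have G': "unit_circle_integral f (w_hat0 w t) = - of_real (4 * pi\<^sup>2) * (\<gamma> * fourier v t + H t)" for t
    using G[OF le1] by (simp add: w_hat0_eq_fourier[OF w] v_def H_def)
  have pos: "variance_pos w f \<nu> = Lim sequentially (\<lambda>N. \<gamma> * S \<nu> N + Q \<nu> N)" for \<nu>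
  proof -
    have "- of_real (\<nu> / (4 * pi\<^sup>2)) * (\<Sum>k\<in>{- int N..int N}. unit_circle_integral f (w_hat w \<nu> k)) = \<gamma> * S \<nu> N + Q \<nu> N" for N
    proof -
      have "(\<Sum>k\<in>{- int N..int N}. unit_circle_integral f (w_hat w \<nu> k)) = - of_real (4 * pi\<^sup>2) *
          (\<gamma> * (\<Sum>k\<in>{- int N..int N}. fourier v (of_int k * \<nu>)) + (\<Sum>k\<in>{- int N..int N}. H (of_int k * \<nu>)))"
        by (simp only: w_hat_eq_w_hat0 G' sum_distrib_left[symmetric] sum.distrib)
      moreover have "- of_real (\<nu> / (4 * pi\<^sup>2)) * (- of_real (4 * pi\<^sup>2) * z) = of_real \<nu> * z" for z :: complex
        by simp
      ultimately show ?thesis by (simp only: S_def Q_def distrib_left mult.left_commute)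
    qed
    then show ?thesis unfolding variance_pos_def by (simp only:)
  qed
  have zero: "variance_zero w f = Lim at_top (\<lambda>T. \<gamma> * J T + integral {-T..T} H)"
  proof -
    have "- of_real (1 / (4 * pi\<^sup>2)) * integral {-T..T} (\<lambda>t. unit_circle_integral f (w_hat0 w t)) =
        \<gamma> * J T + integral {-T..T} H" for T
    proof -
      have "integral {-T..T} (\<lambda>t. \<gamma> * fourier v t + H t) = integral {-T..T} (\<lambda>t. \<gamma> * fourier v t) + integral {-T..T} H"
        by (intro Henstock_Kurzweil_Integration.integral_add integrable_continuous_interval continuous_intros continuous_on_fourier v H.cont)
      then have "integral {-T..T} (\<lambda>t. unit_circle_integral f (w_hat0 w t)) = - of_real (4 * pi\<^sup>2) * (\<gamma> * J T + integral {-T..T} H)"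
        by (simp only: G' integral_mult_right J_def)
      moreover have "- of_real (1 / (4 * pi\<^sup>2)) * (- of_real (4 * pi\<^sup>2) * z) = z" for z :: complex
        by simp
      ultimately show ?thesis by (simp only:)
    qed
    then show ?thesis unfolding variance_zero_def by (simp only:)
  qed
  have Ilim: "((\<lambda>T. integral {-T..T} H) \<longlongrightarrow> I) at_top"
    unfolding I_def by (rule H.symmetric_integral_tendsto)
  have "\<exists>s. Q \<nu> \<longlonglongrightarrow> s \<and> norm (s - I) \<le> \<nu> * A" if "0 < \<nu>" for \<nu>
    using H.riemann_sum_limit[OF that] unfolding Q_def I_def A_def by blast
  then obtain s where s: "\<And>\<nu>. 0 < \<nu> \<Longrightarrow> Q \<nu> \<longlonglongrightarrow> s \<nu>" "\<And>\<nu>. 0 < \<nu> \<Longrightarrow> norm (s \<nu> - I) \<le> \<nu> * A"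
    by metis
  have iff: "S \<nu> \<longlonglongrightarrow> L \<longleftrightarrow> (J \<longlongrightarrow> L) at_top" if "0 < \<nu>" "\<nu> \<le> 1" for \<nu> L
    using symmetric_sum_tendsto_iff[OF v that] unfolding S_def J_def .
  have small: "\<forall>\<^sub>F \<nu> in at_right 0. \<nu> \<in> {0<..<1::real}"
    by (rule eventually_at_right_real) simp
  show ?thesis
  proof (cases "\<gamma> = 0 \<or> (\<exists>L. (J \<longlongrightarrow> L) at_top)")
    case True
    \<comment> \<open>The limit \<open>L\<close> does not depend on \<open>\<nu>\<close>; for
      \<open>\<gamma> = 0\<close> it is 0, even if \<open>J\<close> diverges.\<close>
    have "\<exists>L. ((\<lambda>T. \<gamma> * J T) \<longlongrightarrow> L) at_top \<and> (\<forall>\<nu>. 0 < \<nu> \<longrightarrow> \<nu> \<le> 1 \<longrightarrow> (\<lambda>N. \<gamma> * S \<nu> N) \<longlonglongrightarrow> L)"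
    proof (cases "\<gamma> = 0")
      case \<gamma>: False
      then obtain L where L: "(J \<longlongrightarrow> L) at_top" using True by blast
      then have "S \<nu> \<longlonglongrightarrow> L" if "0 < \<nu>" "\<nu> \<le> 1" for \<nu> using iff[OF that] by simp
      then have "(\<lambda>N. \<gamma> * S \<nu> N) \<longlonglongrightarrow> \<gamma> * L" if "0 < \<nu>" "\<nu> \<le> 1" for \<nu>
        using that by (intro tendsto_mult_left)
      with tendsto_mult_left[OF L] show ?thesis by blast
    qed auto
    then obtain L where L: "((\<lambda>T. \<gamma> * J T) \<longlongrightarrow> L) at_top"
        "\<And>\<nu>. 0 < \<nu> \<Longrightarrow> \<nu> \<le> 1 \<Longrightarrow> (\<lambda>N. \<gamma> * S \<nu> N) \<longlonglongrightarrow> L"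
      by blast
    have val0: "limit_variance w f 0 = L + I"
      using tendsto_Lim[OF trivial_limit_at_top_linorder tendsto_add[OF L(1) Ilim]]
      by (simp add: limit_variance_def zero)
    have "limit_variance w f \<nu> = L + s \<nu>" if "0 < \<nu>" "\<nu> \<le> 1" for \<nu>
      using tendsto_Lim[OF trivial_limit_sequentially tendsto_add[OF L(2)[OF that] s(1)[OF that(1)]]] that
      by (simp add: limit_variance_def pos)
    then have ev: "\<forall>\<^sub>F \<nu> in at_right 0. L + s \<nu> = limit_variance w f \<nu>"
      by (intro eventually_mono[OF small]) auto
    have "((\<lambda>\<nu>. L + s \<nu>) \<longlongrightarrow> L + I) (at_right 0)"
    proof -
      have "((\<lambda>\<nu>. s \<nu> - I) \<longlongrightarrow> 0) (at_right 0)"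
      proof (rule Lim_null_comparison)
        show "\<forall>\<^sub>F \<nu> in at_right 0. norm (s \<nu> - I) \<le> \<nu> * A"
          using small by eventually_elim (auto intro: s(2))
        show "((\<lambda>\<nu>. \<nu> * A) \<longlongrightarrow> 0) (at_right 0)"
          by (rule tendsto_mult_left_zero) (rule tendsto_ident_at)
      qed
      from tendsto_add[OF this tendsto_const[of "L + I"]] show ?thesis by (simp add: algebra_simps)
    qed
    from Lim_transform_eventually[OF this ev] show ?thesis unfolding val0 .
  next
    case False
    \<comment> \<open>Here \<open>\<gamma> \<noteq> 0\<close> and \<open>J\<close> diverges. The
      remainders converge, so every \<open>Lim\<close> involved is taken of a divergent family and
      denotes the same unspecified value.\<close>
    have "limit_variance w f \<nu> = limit_variance w f 0" if "0 < \<nu>" "\<nu> \<le> 1" for \<nu>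
    proof -
      have "\<nexists>l. ((\<lambda>T. \<gamma> * J T + integral {-T..T} H) \<longlongrightarrow> l) at_top"
        using False by (auto simp: tendsto_affine_iff[OF Ilim])
      moreover have "\<nexists>l. (\<lambda>N. \<gamma> * S \<nu> N + Q \<nu> N) \<longlonglongrightarrow> l"
        using False by (auto simp: tendsto_affine_iff[OF s(1)[OF that(1)]] iff[OF that])
      ultimately have "variance_pos w f \<nu> = variance_zero w f"
        unfolding pos zero by (intro Lim_eq_if_divergent)
      then show ?thesis using that by (simp add: limit_variance_def)
    qed
    then have "\<forall>\<^sub>F \<nu> in at_right 0. limit_variance w f \<nu> = limit_variance w f 0"
      by (intro eventually_mono[OF small]) auto
    then show ?thesis by (rule tendsto_eventually)
  qed
qed

theorem mainTheorem2:
  fixes w :: "real \<Rightarrow> real" and f :: "complex \<Rightarrow> complex" and \<rho> \<tau> \<alpha> :: real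
    and P :: "'a measure" and B :: band_type and c :: "nat \<Rightarrow> real"
    and x :: "nat \<Rightarrow> nat \<Rightarrow> nat \<Rightarrow> 'a \<Rightarrow> complex"
  assumes "variance_profile w"
    and "band_ensemble P B c \<alpha> x"
    and "norm_constant P w B c \<alpha> x \<rho>"
    and "\<tau> > 0"
    and "f analytic_on cball 0 (\<rho> + \<tau>)"
    and "bounded (f ` (- cball 0 (\<rho> + \<tau>)))"
  shows "((\<lambda>\<nu>. limit_variance w f \<nu>) \<longlongrightarrow> limit_variance w f 0) (at_right 0)"
proof (rule limit_variance_tendsto)
  show "f holomorphic_on ball 0 (\<rho> + \<tau>)"
    using assms(5) analytic_imp_holomorphic holomorphic_on_subset ball_subset_cball by blast
  \<comment> \<open>The norm constant satisfies \<open>\<rho> \<ge> 1\<close>, so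
    \<open>\<tau>\<close> supplies the room beyond the unit circle.\<close>
  show "1 < \<rho> + \<tau>"
    using assms(3,4) by (simp add: norm_constant_def)
qed (rule assms(1))

end
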